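(* Let $[t_0,t_1]$ be an admissible segment of $\mathbf r$ with associated tetrahedron $\mathbf r_0\mathbf r_1\mathbf r_2\mathbf r_3$. For each $t^\star\in(t_0,t_1)$ the osculating plane $O(t^\star)$ meets the lines $\mathbf r_0\mathbf r_1$, $\mathbf r_1\mathbf r_2$, $\mathbf r_2\mathbf r_3$ in points $\mathbf r_{01},\mathbf r_{12},\mathbf r_{23}$ (depending on $t^\star$), and the distances $\|\mathbf r_0\mathbf r_{01}\|$, $\|\mathbf r_1\mathbf r_{12}\|$, $\|\mathbf r_2\mathbf r_{23}\|$ are strictly monotone functions of $t^\star\in(t_0,t_1)$.
   Context: Setting: $\mathbf r(t)=(x(t),y(t),z(t))$ with $x,y,z$ rational functions with real coefficients whose denominators do not vanish on the parameter interval, properly parametrized, and not contained in a plane. Curvature $\kappa=\|\mathbf r'\times\mathbf r''\|/\|\mathbf r'\|^3$; torsion $\tau$ vanishes exactly where $\det(\mathbf r',\mathbf r'',\mathbf r''')=0$. Unit tangent $\boldsymbol\alpha=\mathbf r'/\|\mathbf r'\|$, unit binormal $\boldsymbol\gamma=\mathbf r'\times\mathbf r''/\|\mathbf r'\times\mathbf r''\|$; one-sided limits $\boldsymbol\alpha^{\pm}(s)=\lim_{t\to s^\pm}\boldsymbol\alpha(t)$, $\boldsymbol\gamma^{\pm}(s)=\lim_{t\to s^\pm}\boldsymbol\gamma(t)$; tangent lines $T^{\pm}(s)=\{\mathbf r(s)+\lambda\boldsymbol\alpha^{\pm}(s)\}$, osculating planes $O^{\pm}(s)=\{X:(X-\mathbf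 r(s))\cdot\boldsymbol\gamma^{\pm}(s)=0\}$ (written $O(s)$ at interior ordinary points). A point is singular if it corresponds to more than one parameter counted with multiplicity; character points are singular points, inflections ($\kappa=0$) and torsion-vanishing points ($\tau=0$). Associated tetrahedron of $[a,b]$: vertices $\mathbf r(a)$, $T^+(a)\cap L$, $T^-(b)\cap L$, $\mathbf r(b)$ where $L=O^+(a)\cap O^-(b)$. Admissible segment: $t_0<t_1$, no parameter in $(t_0,t_1]$ gives a character point, and for all $t_0\le s_1<s_2\le t_1$: (I) $\boldsymbol\alpha^+(s_1)\cdot\boldsymbol\gamma^-(s_2)\ne0$ and $\boldsymbol\alpha^-(s_2)\cdot\boldsymbol\gamma^+(s_1)\ne0$; (II) $(\boldsymbol\alpha^+(s_1)\times(\mathbf r(s_2)-\mathbf r(s_1)))\cdot\boldsymbol\alpha^-(s_2)\ne0$; (III) $(\mathbf r(s_1)-\mathbf r(s_2))\cdot\boldsymbol\gamma^-(s_2)\ne0$ and $(\mathbf r(s_2)-\mathbf r(s_1))\cdot\boldsymbol\gamma^+(s_1)\ne0$; and (IV) for all $t_0\le s_1<s_2<s_3\le t_1$, $\det(\boldsymbol\alpha(s_1),\boldsymbol\alpha(s_2),\boldsymbol\alpha(s_3))\ne0$ (one-sided limits used at $t_0,t_1$). *)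

theory Defs
  imports "HOL-Analysis.Analysis" "HOL-Computational_Algebra.Polynomial"
begin

definition rcurve :: "real poly ^ 3 \<Rightarrow> real poly ^ 3 \<Rightarrow> real \<Rightarrow> real ^ 3" where
  "rcurve P Q t = (\<chi> i. poly (P $ i) t / poly (Q $ i) t)"

definition rcurve_C :: "real poly ^ 3 \<Rightarrow> real poly ^ 3 \<Rightarrow> complex \<Rightarrow> complex ^ 3" where
  "rcurve_C P Q z = (\<chi> i. poly (map_poly complex_of_real (P $ i)) z
                         / poly (map_poly complex_of_real (Q $ i)) z)"

definition regular_param_C :: "real poly ^ 3 \<Rightarrow> complex \<Rightarrow> bool" where
  "regular_param_C Q z \<longleftrightarrow> (\<forall>i. poly (map_poly complex_of_real (Q $ i)) z \<noteq> 0)"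

text \<open>Proper (birational) parametrization: all but finitely many (complex) parameter
  values are the unique parameter of their image point.\<close>
definition proper_param :: "real poly ^ 3 \<Rightarrow> real poly ^ 3 \<Rightarrow> bool" where
  "proper_param P Q \<longleftrightarrow>
     finite {z. regular_param_C Q z \<and>
               (\<exists>w. w \<noteq> z \<and> regular_param_C Q w \<and> rcurve_C P Q w = rcurve_C P Q z)}"

definition contained_in_plane :: "(real \<Rightarrow> real ^ 3) \<Rightarrow> real set \<Rightarrow> bool" where
  "contained_in_plane r I \<longleftrightarrow> (\<exists>n c. n \<noteq> 0 \<and> (\<forall>t\<in>I. n \<bullet> r t = c))"

definition d1 :: "(real \<Rightarrow> real ^ 3) \<Rightarrow> real \<Rightarrow> real ^ 3" where
  "d1 r t = vector_derivative r (at t)"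

definition d2 :: "(real \<Rightarrow> real ^ 3) \<Rightarrow> real \<Rightarrow> real ^ 3" where
  "d2 r t = vector_derivative (d1 r) (at t)"

definition d3 :: "(real \<Rightarrow> real ^ 3) \<Rightarrow> real \<Rightarrow> real ^ 3" where
  "d3 r t = vector_derivative (d2 r) (at t)"

definition curvature :: "(real \<Rightarrow> real ^ 3) \<Rightarrow> real \<Rightarrow> real" where
  "curvature r t = norm (cross3 (d1 r t) (d2 r t)) / norm (d1 r t) ^ 3"

definition torsion_vanishes :: "(real \<Rightarrow> real ^ 3) \<Rightarrow> real \<Rightarrow> bool" where
  "torsion_vanishes r t \<longleftrightarrow> det (vector [d1 r t, d2 r t, d3 r t] :: real ^ 3 ^ 3) = 0"

definition utan :: "(real \<Rightarrow> real ^ 3) \<Rightarrow> real \<Rightarrow> real ^ 3" where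
  "utan r t = (1 / norm (d1 r t)) *\<^sub>R d1 r t"

definition ubin :: "(real \<Rightarrow> real ^ 3) \<Rightarrow> real \<Rightarrow> real ^ 3" where
  "ubin r t = (1 / norm (cross3 (d1 r t) (d2 r t))) *\<^sub>R cross3 (d1 r t) (d2 r t)"

definition alpha_p :: "(real \<Rightarrow> real ^ 3) \<Rightarrow> real \<Rightarrow> real ^ 3" where
  "alpha_p r s = Lim (at_right s) (utan r)"
definition alpha_m :: "(real \<Rightarrow> real ^ 3) \<Rightarrow> real \<Rightarrow> real ^ 3" where
  "alpha_m r s = Lim (at_left s) (utan r)"
definition gamma_p :: "(real \<Rightarrow> real ^ 3) \<Rightarrow> real \<Rightarrow> real ^ 3" where
  "gamma_p r s = Lim (at_right s) (ubin r)"
definition gamma_m :: "(real \<Rightarrow> real ^ 3) \<Rightarrow> real \<Rightarrow> real ^ 3" where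
  "gamma_m r s = Lim (at_left s) (ubin r)"

definition tangent_p :: "(real \<Rightarrow> real ^ 3) \<Rightarrow> real \<Rightarrow> (real ^ 3) set" where
  "tangent_p r s = {r s + l *\<^sub>R alpha_p r s | l. True}"
definition tangent_m :: "(real \<Rightarrow> real ^ 3) \<Rightarrow> real \<Rightarrow> (real ^ 3) set" where
  "tangent_m r s = {r s + l *\<^sub>R alpha_m r s | l. True}"

definition osc_p :: "(real \<Rightarrow> real ^ 3) \<Rightarrow> real \<Rightarrow> (real ^ 3) set" where
  "osc_p r s = {X. (X - r s) \<bullet> gamma_p r s = 0}"
definition osc_m :: "(real \<Rightarrow> real ^ 3) \<Rightarrow> real \<Rightarrow> (real ^ 3) set" where
  "osc_m r s = {X. (X - r s) \<bullet> gamma_m r s = 0}"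
definition osc :: "(real \<Rightarrow> real ^ 3) \<Rightarrow> real \<Rightarrow> (real ^ 3) set" where
  "osc r s = {X. (X - r s) \<bullet> ubin r s = 0}"

definition singular_param :: "(real \<Rightarrow> real ^ 3) \<Rightarrow> real set \<Rightarrow> real \<Rightarrow> bool" where
  "singular_param r I s \<longleftrightarrow> (\<exists>s'\<in>I. s' \<noteq> s \<and> r s' = r s) \<or> d1 r s = 0"

definition character_param :: "(real \<Rightarrow> real ^ 3) \<Rightarrow> real set \<Rightarrow> real \<Rightarrow> bool" where
  "character_param r I s \<longleftrightarrow>
     singular_param r I s \<or> curvature r s = 0 \<or> torsion_vanishes r s"

definition alpha_seg :: "(real \<Rightarrow> real ^ 3) \<Rightarrow> real \<Rightarrow> real \<Rightarrow> real \<Rightarrow> real ^ 3" where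
  "alpha_seg r t0 t1 s =
     (if s = t0 then alpha_p r t0 else if s = t1 then alpha_m r t1 else utan r s)"

definition admissible :: "(real \<Rightarrow> real ^ 3) \<Rightarrow> real set \<Rightarrow> real \<Rightarrow> real \<Rightarrow> bool" where
  "admissible r I t0 t1 \<longleftrightarrow>
     t0 < t1 \<and> {t0..t1} \<subseteq> I \<and>
     (\<forall>t\<in>{t0<..t1}. \<not> character_param r I t) \<and>
     (\<forall>s1 s2. t0 \<le> s1 \<and> s1 < s2 \<and> s2 \<le> t1 \<longrightarrow>
        alpha_p r s1 \<bullet> gamma_m r s2 \<noteq> 0 \<and>
        alpha_m r s2 \<bullet> gamma_p r s1 \<noteq> 0 \<and>
        cross3 (alpha_p r s1) (r s2 - r s1) \<bullet> alpha_m r s2 \<noteq> 0 \<and>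
        (r s1 - r s2) \<bullet> gamma_m r s2 \<noteq> 0 \<and>
        (r s2 - r s1) \<bullet> gamma_p r s1 \<noteq> 0) \<and>
     (\<forall>s1 s2 s3. t0 \<le> s1 \<and> s1 < s2 \<and> s2 < s3 \<and> s3 \<le> t1 \<longrightarrow>
        det (vector [alpha_seg r t0 t1 s1, alpha_seg r t0 t1 s2, alpha_seg r t0 t1 s3]
               :: real ^ 3 ^ 3) \<noteq> 0)"

text \<open>Vertices of the associated tetrahedron of [a,b]: r(a), T+(a) \<inter> L, T-(b) \<inter> L, r(b),
  where L = O+(a) \<inter> O-(b).\<close>
definition tetra_L :: "(real \<Rightarrow> real ^ 3) \<Rightarrow> real \<Rightarrow> real \<Rightarrow> (real ^ 3) set" where
  "tetra_L r a b = osc_p r a \<inter> osc_m r b"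

definition tetra_v1 :: "(real \<Rightarrow> real ^ 3) \<Rightarrow> real \<Rightarrow> real \<Rightarrow> real ^ 3" where
  "tetra_v1 r a b = (THE X. X \<in> tangent_p r a \<inter> tetra_L r a b)"

definition tetra_v2 :: "(real \<Rightarrow> real ^ 3) \<Rightarrow> real \<Rightarrow> real \<Rightarrow> real ^ 3" where
  "tetra_v2 r a b = (THE X. X \<in> tangent_m r b \<inter> tetra_L r a b)"

definition line_through :: "real ^ 3 \<Rightarrow> real ^ 3 \<Rightarrow> (real ^ 3) set" where
  "line_through p q = {p + u *\<^sub>R (q - p) | u. True}"

end

theory Submission
  imports Defs
begin

text \<open>
  Write \<open>v\<close>, \<open>w\<close>, \<open>j\<close> for the first three derivatives of \<open>r\<close>, \<open>b = v \<times> w\<close> and \<open>D = det(v, w, j)\<close>.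
  The osculating plane at \<open>t\<close> cuts the tangent \<open>r(e) + u \<alpha>\<close> at an endpoint \<open>e\<close> in
  \<open>u = ((r - r(e)) \<bullet> b) / (\<alpha> \<bullet> b)\<close>, and since \<open>b' = v \<times> j\<close> one gets \<open>u' = D E / K\<^sup>2\<close> with
  \<open>K = \<alpha> \<bullet> b\<close> and \<open>E = \<alpha> \<bullet> ((r - r(e)) \<times> v)\<close>. Projecting the curve along \<open>\<alpha>\<close> and applying
  Cauchy's mean value theorem to the slope of the projection shows that \<open>E\<close> and \<open>K\<close> have the same
  sign. So \<open>u\<close> is strictly monotone, and comparison with its limit at the opposite endpoint tells
  on which side of the osculating plane the vertex on this tangent lies: the two middle vertices
  are on opposite sides. On the middle edge the parameter of the cut is \<open>F\<^sub>1 / (F\<^sub>1 - F\<^sub>2)\<close> with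
  \<open>F\<^sub>i = (r\<^sub>i - r) \<bullet> b\<close>, and its derivative is \<open>D ((r\<^sub>1 - r) \<times> (r\<^sub>2 - r)) \<bullet> v\<close> over a square. As that edge
  is parallel to \<open>\<gamma>\<^sub>0 \<times> \<gamma>\<^sub>1\<close>, the triple product is a multiple of \<open>A B' - A' B\<close>, where \<open>A\<close>, \<open>B\<close> are
  the heights of \<open>r\<close> over the two end osculating planes; one height grows and the other shrinks in
  absolute value, so this does not vanish.
\<close>

section \<open>Calculus on intervals: product rules, constant signs, strict monotonicity\<close>

lemma has_vector_derivative_cross3:
  assumes "(f has_vector_derivative f') (at x)" "(g has_vector_derivative g') (at x)"
  shows "((\<lambda>x. cross3 (f x) (g x)) has_vector_derivative (cross3 (f x) g' + cross3 f' (g x))) (at x)"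
  using bounded_bilinear.has_vector_derivative[OF bilinear_cross[unfolded bilinear_conv_bounded_bilinear]] assms .

lemma has_real_derivative_inner_left:
  fixes f :: "real \<Rightarrow> 'a::real_inner"
  assumes "(f has_vector_derivative f') (at x)"
  shows "((\<lambda>x. c \<bullet> f x) has_real_derivative (c \<bullet> f')) (at x)"
  using bounded_linear.has_vector_derivative[OF bounded_linear_inner_right assms]
  by (simp add: has_real_derivative_iff_has_vector_derivative)

lemma has_real_derivative_inner:
  fixes f g :: "real \<Rightarrow> 'a::real_inner"
  assumes "(f has_vector_derivative f') (at x)" "(g has_vector_derivative g') (at x)"
  shows "((\<lambda>x. f x \<bullet> g x) has_real_derivative (f x \<bullet> g' + f' \<bullet> g x)) (at x)"
  using bounded_bilinear.has_vector_derivative[OF bounded_bilinear_inner] assms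
  by (simp add: has_real_derivative_iff_has_vector_derivative)

text \<open>A connected image that avoids 0 cannot contain values of both signs. The sign comes as a
  factor \<sigma> so that later arguments multiply by it instead of splitting into cases.\<close>

lemma constant_sign_on_interval:
  fixes f :: "real \<Rightarrow> real"
  assumes "continuous_on {a<..<b} f" and "\<And>t. t \<in> {a<..<b} \<Longrightarrow> f t \<noteq> 0"
  obtains \<sigma> where "\<sigma> = 1 \<or> \<sigma> = - 1" and "\<And>t. t \<in> {a<..<b} \<Longrightarrow> \<sigma> * f t > 0"
proof -
  have "connected (f ` {a<..<b})"
    by (rule connected_continuous_image[OF assms(1)]) (simp add: is_interval_connected_1[symmetric])
  then have iv: "x \<in> f ` {a<..<b} \<Longrightarrow> y \<in> f ` {a<..<b} \<Longrightarrow> x < 0 \<Longrightarrow> 0 < y \<Longrightarrow> False" for x y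
    using assms(2) unfolding connected_iff_interval by (metis imageE less_imp_le)
  show thesis
  proof (cases "\<exists>t\<in>{a<..<b}. f t < 0")
    case True
    then have "f t < 0" if "t \<in> {a<..<b}" for t
      using iv assms(2) that by (metis imageI linorder_neqE_linordered_idom)
    then show thesis by (intro that[of "-1"]) auto
  next
    case False
    then show thesis using assms(2) by (intro that[of 1]) force+
  qed
qed

lemma strict_mono_on_if_deriv_pos:
  fixes f f' :: "real \<Rightarrow> real"
  assumes "\<And>t. t \<in> {a<..<b} \<Longrightarrow> (f has_real_derivative f' t) (at t)"
    and "\<And>t. t \<in> {a<..<b} \<Longrightarrow> f' t > 0"
  shows "strict_mono_on {a<..<b} f"
proof (rule strict_mono_onI)
  fix x y assume xy: "x \<in> {a<..<b}" "y \<in> {a<..<b}" "x < y"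
  show "f x < f y"
    by (rule DERIV_pos_imp_increasing[OF xy(3)]) (use assms xy in \<open>meson atLeastAtMost_iff greaterThanLessThan_iff le_less_trans less_le_trans\<close>)
qed

text \<open>Strictness survives the passage to the limit through a point \<open>s\<close> strictly
  between \<open>t\<close> and \<open>b\<close>: \<open>f t < f s \<le> l\<close>.\<close>

lemma strict_mono_on_less_limit_right:
  fixes f :: "real \<Rightarrow> real"
  assumes "strict_mono_on {a<..<b} f" "(f \<longlongrightarrow> l) (at_left b)" "t \<in> {a<..<b}"
  shows "f t < l"
proof -
  obtain s where s: "t < s" "s < b" using assms(3) dense by auto
  have "f s \<le> l"
  proof (rule tendsto_lowerbound[OF assms(2)])
    show "\<forall>\<^sub>F x in at_left b. f s \<le> f x"
      unfolding eventually_at_left_field using s assms(1,3)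
      by (intro exI[of _ s]) (auto intro!: less_imp_le strict_mono_onD[OF assms(1)])
  qed simp
  moreover have "f t < f s" using s assms by (auto intro!: strict_mono_onD[OF assms(1)])
  ultimately show ?thesis by simp
qed

lemma strict_mono_on_greater_limit_left:
  fixes f :: "real \<Rightarrow> real"
  assumes "strict_mono_on {a<..<b} f" "(f \<longlongrightarrow> l) (at_right a)" "t \<in> {a<..<b}"
  shows "l < f t"
proof -
  obtain s where s: "a < s" "s < t" using assms(3) dense by auto
  have "l \<le> f s"
  proof (rule tendsto_upperbound[OF assms(2)])
    show "\<forall>\<^sub>F x in at_right a. f x \<le> f s"
      unfolding eventually_at_right_field using s assms(1,3)
      by (intro exI[of _ s]) (auto intro!: less_imp_le strict_mono_onD[OF assms(1)])
  qed simp
  moreover have "f s < f t" using s assms by (auto intro!: strict_mono_onD[OF assms(1)])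
  ultimately show ?thesis by simp
qed

text \<open>The chord slope \<open>C / A\<close> equals an earlier tangent slope \<open>C' / A'\<close>, which is decreasing.\<close>

lemma quotient_wronskian_pos:
  fixes A A' A'' C C' C'' :: "real \<Rightarrow> real"
  assumes et: "e < t"
    and dA: "\<And>x. x \<in> {e..t} \<Longrightarrow> (A has_real_derivative A' x) (at x)"
    and dC: "\<And>x. x \<in> {e..t} \<Longrightarrow> (C has_real_derivative C' x) (at x)"
    and dA': "\<And>x. x \<in> {e<..t} \<Longrightarrow> (A' has_real_derivative A'' x) (at x)"
    and dC': "\<And>x. x \<in> {e<..t} \<Longrightarrow> (C' has_real_derivative C'' x) (at x)"
    and A0: "A e = 0" and C0: "C e = 0"
    and A'pos: "\<And>x. x \<in> {e<..t} \<Longrightarrow> A' x > 0"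
    and K: "\<And>x. x \<in> {e<..t} \<Longrightarrow> C' x * A'' x - A' x * C'' x > 0"
  shows "C t * A' t - A t * C' t > 0"
proof -
  obtain x where x: "e < x" "x < t" and eq: "C t * A' x = A t * C' x"
    using GMVT'[OF et, of C A A' C'] dA dC A0 C0
    by (auto intro: DERIV_isCont)
  \<comment> \<open>\<open>A'\<close> is positive only to the right of \<open>e\<close>; at
    \<open>e\<close> itself it may vanish, as the derivative of the height over an osculating plane
    does. Hence the monotonicity criterion on the open interval.\<close>
  have "A e < A t"
  proof (rule DERIV_pos_imp_increasing_open[OF et])
    show "\<exists>y. (A has_real_derivative y) (at s) \<and> 0 < y" if "e < s" "s < t" for s
      using dA A'pos that by (metis atLeastAtMost_iff greaterThanAtMost_iff less_imp_le)
    show "continuous_on {e..t} A"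
      using dA by (meson DERIV_isCont continuous_at_imp_continuous_on)
  qed
  then have At: "A t > 0" using A0 by simp
  have "C' x / A' x > C' t / A' t"
  proof (rule DERIV_neg_imp_decreasing[OF x(2)])
    fix s assume s: "x \<le> s" "s \<le> t"
    then have s': "s \<in> {e<..t}" using x by auto
    have "((\<lambda>s. C' s / A' s) has_real_derivative (C'' s * A' s - C' s * A'' s) / (A' s * A' s)) (at s)"
      using DERIV_divide[OF dC'[OF s'] dA'[OF s']] A'pos[OF s'] by simp
    moreover have "(C'' s * A' s - C' s * A'' s) / (A' s * A' s) < 0"
      using K[OF s'] A'pos[OF s'] by (intro divide_neg_pos) (auto simp: algebra_simps)
    ultimately show "\<exists>y. ((\<lambda>s. C' s / A' s) has_real_derivative y) (at s) \<and> y < 0" by blast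
  qed
  then have "C' t * A' x < C' x * A' t"
    using A'pos[of x] A'pos[of t] x by (simp add: field_simps)
  then have "A t * (C' t * A' x) < A t * (C' x * A' t)" using At by simp
  also have "\<dots> = C t * A' x * A' t" using eq by (simp add: mult.assoc[symmetric])
  finally have "A' x * (A t * C' t) < A' x * (C t * A' t)" by (simp add: mult_ac)
  then show ?thesis using A'pos[of x] x by simp
qed

section \<open>Osculating planes along one end tangent\<close>

text \<open>Derivatives exist on both sides even at \<open>a\<close> and \<open>b\<close>, but
  nothing has to be nonzero there, which leaves room for a singular point at an end.\<close>

locale space_curve =
  fixes r v w j :: "real \<Rightarrow> real ^ 3" and a b :: real
  assumes ab: "a < b"
    and dr: "\<And>t. t \<in> {a..b} \<Longrightarrow> (r has_vector_derivative v t) (at t)"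
    and dv: "\<And>t. t \<in> {a..b} \<Longrightarrow> (v has_vector_derivative w t) (at t)"
    and dw: "\<And>t. t \<in> {a..b} \<Longrightarrow> (w has_vector_derivative j t) (at t)"
    and jcont: "continuous_on {a..b} j"
    and D: "\<And>t. t \<in> {a<..<b} \<Longrightarrow> cross3 (v t) (w t) \<bullet> j t \<noteq> 0"
begin

lemma rcont: "continuous_on {a..b} r" and vcont: "continuous_on {a..b} v"
  and wcont: "continuous_on {a..b} w"
  using dr dv dw by (meson continuous_at_imp_continuous_on has_vector_derivative_continuous)+

lemma db:
  assumes "t \<in> {a..b}"
  shows "((\<lambda>t. cross3 (v t) (w t)) has_vector_derivative cross3 (v t) (j t)) (at t)"
  using has_vector_derivative_cross3[OF dv[OF assms] dw[OF assms]] by simp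

end

text \<open>One locale serves both ends. \<alpha> and \<gamma> stand for the one-sided unit tangent
  and binormal at \<open>e\<close>; they are not expressed by \<open>v e\<close> and
  \<open>w e\<close>, which may degenerate at a singular point.\<close>

locale tangent_end = space_curve +
  fixes e :: real and \<alpha> \<gamma> :: "real ^ 3"
  assumes e: "e = a \<or> e = b"
    and orth: "\<alpha> \<bullet> \<gamma> = 0" and gnz: "\<gamma> \<noteq> 0"
    and K: "\<And>t. t \<in> {a<..<b} \<Longrightarrow> \<alpha> \<bullet> cross3 (v t) (w t) \<noteq> 0"
    and A': "\<And>t. t \<in> {a<..<b} \<Longrightarrow> v t \<bullet> \<gamma> \<noteq> 0"
begin

text \<open>By the mean value theorem the height over the end plane is \<open>t - e\<close> times a
  value of \<open>v \<bullet> \<gamma>\<close>, which has constant sign. The factor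
  \<open>t - e\<close> covers both ends: positive for \<open>e = a\<close>, negative for
  \<open>e = b\<close>.\<close>

lemma height_mult_deriv:
  assumes t: "t \<in> {a<..<b}"
  shows "((r t - r e) \<bullet> \<gamma>) * (v t \<bullet> \<gamma>) * (t - e) > 0"
proof -
  obtain \<sigma> where \<sigma>: "\<sigma> = 1 \<or> \<sigma> = - 1" "\<And>t. t \<in> {a<..<b} \<Longrightarrow> \<sigma> * (v t \<bullet> \<gamma>) > 0"
  proof (rule constant_sign_on_interval[of a b "\<lambda>t. v t \<bullet> \<gamma>"])
    show "continuous_on {a<..<b} (\<lambda>t. v t \<bullet> \<gamma>)"
      by (intro continuous_intros continuous_on_subset[OF vcont]) auto
  qed (use A' in auto)
  have d: "((\<lambda>t. (r t - r e) \<bullet> \<gamma>) has_real_derivative (v x \<bullet> \<gamma>)) (at x)" if "x \<in> {a..b}" for x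
    using has_real_derivative_inner_left[OF has_vector_derivative_diff[OF dr[OF that]
        has_vector_derivative_const[of "r e"]], of \<gamma>]
    by (simp add: inner_commute)
  have "\<exists>z\<in>{a<..<b}. (r t - r e) \<bullet> \<gamma> = (t - e) * (v z \<bullet> \<gamma>)"
  proof (cases "e = a")
    case True
    then have "e < t" using t by auto
    from MVT2[OF this, of "\<lambda>t. (r t - r e) \<bullet> \<gamma>" "\<lambda>x. v x \<bullet> \<gamma>"] d
    obtain z where "z > e" "z < t" "(r t - r e) \<bullet> \<gamma> = (t - e) * (v z \<bullet> \<gamma>)" 
      using t True by auto
    then show ?thesis using t True by auto
  next
    case False
    then have eb: "e = b" using e by auto
    then have "t < e" using t by auto
    from MVT2[OF this, of "\<lambda>t. (r t - r e) \<bullet> \<gamma>" "\<lambda>x. v x \<bullet> \<gamma>"] d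
    obtain z where "z > t" "z < e" "- ((r t - r e) \<bullet> \<gamma>) = (e - t) * (v z \<bullet> \<gamma>)" 
      using t eb by auto
    then show ?thesis using t eb by (intro bexI[of _ z]) (auto simp: algebra_simps)
  qed
  then obtain z where z: "z \<in> {a<..<b}" "(r t - r e) \<bullet> \<gamma> = (t - e) * (v z \<bullet> \<gamma>)" by blast
  have "((r t - r e) \<bullet> \<gamma>) * (v t \<bullet> \<gamma>) * (t - e)
      = (t - e)\<^sup>2 * ((\<sigma> * (v z \<bullet> \<gamma>)) * (\<sigma> * (v t \<bullet> \<gamma>)))"
    using z(2) \<sigma>(1) by (auto simp: power2_eq_square)
  also have "\<dots> > 0"
    by (intro mult_pos_pos \<sigma>(2)[OF z(1)] \<sigma>(2)[OF t]) (use e t in auto)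
  finally show ?thesis .
qed

text \<open>Projection along \<alpha> has coordinates along \<gamma> and
  \<open>cross3 \<gamma> \<alpha>\<close>. The planar determinant of two projected vectors is their
  triple product with \<alpha>, up to the squared length of \<gamma>.\<close>

lemma lagrange_orthogonal_frame:
  "(p \<bullet> cross3 \<gamma> \<alpha>) * (q \<bullet> \<gamma>) - (p \<bullet> \<gamma>) * (q \<bullet> cross3 \<gamma> \<alpha>) = (\<gamma> \<bullet> \<gamma>) * (\<alpha> \<bullet> cross3 p q)"
proof -
  have "cross3 (cross3 \<gamma> \<alpha>) \<gamma> = (\<gamma> \<bullet> \<gamma>) *\<^sub>R \<alpha>"
    using Lagrange[of \<gamma> \<gamma> \<alpha>] cross_skew[of "cross3 \<gamma> \<alpha>" \<gamma>] orth by (simp add: inner_commute)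
  then show ?thesis
    using dot_cross[of p q "cross3 \<gamma> \<alpha>" \<gamma>] by (simp add: inner_commute)
qed

text \<open>In the coordinates \<open>A\<close> along \<gamma> and \<open>C\<close> along
  \<open>cross3 \<gamma> \<alpha>\<close> of the projected curve, the two factors are, up to
  \<open>\<gamma> \<bullet> \<gamma>\<close>, the determinants \<open>C A' - A C'\<close> and
  \<open>C' A'' - A' C''\<close>. So \<open>quotient_wronskian_pos\<close> passes the sign of the
  second to the first.\<close>

lemma tangent_binormal_sign:
  assumes t: "t \<in> {a<..<b}"
  shows "(\<alpha> \<bullet> cross3 (r t - r e) (v t)) * (\<alpha> \<bullet> cross3 (v t) (w t)) > 0"
proof -
  obtain \<sigma> where \<sigma>: "\<sigma> = 1 \<or> \<sigma> = - 1" "\<And>t. t \<in> {a<..<b} \<Longrightarrow> \<sigma> * (v t \<bullet> \<gamma>) > 0"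
  proof (rule constant_sign_on_interval[of a b "\<lambda>t. v t \<bullet> \<gamma>"])
    show "continuous_on {a<..<b} (\<lambda>t. v t \<bullet> \<gamma>)"
      by (intro continuous_intros continuous_on_subset[OF vcont]) auto
  qed (use A' in auto)
  obtain \<rho> where \<rho>: "\<rho> = 1 \<or> \<rho> = - 1" "\<And>t. t \<in> {a<..<b} \<Longrightarrow> \<rho> * (\<alpha> \<bullet> cross3 (v t) (w t)) > 0"
  proof (rule constant_sign_on_interval[of a b "\<lambda>t. \<alpha> \<bullet> cross3 (v t) (w t)"])
    show "continuous_on {a<..<b} (\<lambda>t. \<alpha> \<bullet> cross3 (v t) (w t))"
      by (intro continuous_intros continuous_on_cross continuous_on_subset[OF vcont] 
          continuous_on_subset[OF wcont]) auto
  qed (use K in auto)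
  have gg: "\<gamma> \<bullet> \<gamma> > 0" using gnz by simp
  have d: "((\<lambda>t. c * ((r t - r e) \<bullet> p)) has_real_derivative (c * (v x \<bullet> p))) (at x)"
    and d': "((\<lambda>t. c * (v t \<bullet> p)) has_real_derivative (c * (w x \<bullet> p))) (at x)"
    if "x \<in> {a..b}" for x p c
    using has_real_derivative_inner_left[OF has_vector_derivative_diff[OF dr[OF that]
        has_vector_derivative_const[of "r e"]], of p, THEN DERIV_cmult[where c = c]]
      has_real_derivative_inner_left[OF dv[OF that], of p, THEN DERIV_cmult[where c = c]]
    by (simp_all add: inner_commute)
  have main: "\<rho> * (\<alpha> \<bullet> cross3 (r t - r e) (v t)) > 0"
  proof (cases "e = a")
    case True
    \<comment> \<open>The factor \<sigma> makes \<open>A'\<close> positive; \<sigma>\<rho> on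
      \<open>C\<close> leaves \<rho> in both determinants and makes the second one positive.\<close>
    have "0 < (\<sigma> * \<rho> * ((r t - r e) \<bullet> cross3 \<gamma> \<alpha>)) * (\<sigma> * (v t \<bullet> \<gamma>)) - (\<sigma> * ((r t - r e) \<bullet> \<gamma>)) * (\<sigma> * \<rho> * (v t \<bullet> cross3 \<gamma> \<alpha>))"
    proof (rule quotient_wronskian_pos[where e = a and t = t
          and A = "\<lambda>t. \<sigma> * ((r t - r e) \<bullet> \<gamma>)" and A' = "\<lambda>t. \<sigma> * (v t \<bullet> \<gamma>)" and A'' = "\<lambda>t. \<sigma> * (w t \<bullet> \<gamma>)"
          and C = "\<lambda>t. \<sigma> * \<rho> * ((r t - r e) \<bullet> cross3 \<gamma> \<alpha>)" and C' = "\<lambda>t. \<sigma> * \<rho> * (v t \<bullet> cross3 \<gamma> \<alpha>)" and C'' = "\<lambda>t. \<sigma> * \<rho> * (w t \<bullet> cross3 \<gamma> \<alpha>)"])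
      fix x assume "x \<in> {a<..t}"
      then have x: "x \<in> {a<..<b}" using t by auto
      have "(\<sigma> * \<rho> * (v x \<bullet> cross3 \<gamma> \<alpha>)) * (\<sigma> * (w x \<bullet> \<gamma>)) - (\<sigma> * (v x \<bullet> \<gamma>)) * (\<sigma> * \<rho> * (w x \<bullet> cross3 \<gamma> \<alpha>))
         = (\<gamma> \<bullet> \<gamma>) * (\<rho> * (\<alpha> \<bullet> cross3 (v x) (w x)))"
        using lagrange_orthogonal_frame[of "v x" "w x"] \<sigma>(1) \<rho>(1) by auto
      then show "(\<sigma> * \<rho> * (v x \<bullet> cross3 \<gamma> \<alpha>)) * (\<sigma> * (w x \<bullet> \<gamma>)) - (\<sigma> * (v x \<bullet> \<gamma>)) * (\<sigma> * \<rho> * (w x \<bullet> cross3 \<gamma> \<alpha>)) > 0"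
        using \<rho>(2)[OF x] gg by simp
    next
      fix x assume "x \<in> {a<..t}"
      then have "x \<in> {a<..<b}" using t by auto
      then show "\<sigma> * (v x \<bullet> \<gamma>) > 0" by (rule \<sigma>(2))
    qed (use t True d[unfolded True] d' in auto)
    also have "\<dots> = (\<gamma> \<bullet> \<gamma>) * (\<rho> * (\<alpha> \<bullet> cross3 (r t - r e) (v t)))"
      using lagrange_orthogonal_frame[of "r t - r e" "v t"] \<sigma>(1) \<rho>(1) by auto
    finally show ?thesis using gg by (simp add: zero_less_mult_iff)
  next
    case False
    then have eb: "e = b" using e by auto
    \<comment> \<open>The parameter is reversed so that \<open>b\<close> becomes a left end.\<close>
    have dm: "((\<lambda>t. c * ((r (- t) - r e) \<bullet> p)) has_real_derivative (- c * (v (- x) \<bullet> p))) (at x)"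
      and dm': "((\<lambda>t. c * (v (- t) \<bullet> p)) has_real_derivative (- c * (w (- x) \<bullet> p))) (at x)"
      if "- x \<in> {a..b}" for x p c
      using DERIV_chain2[OF d[OF that, of c p] DERIV_minus[OF DERIV_ident]]
        DERIV_chain2[OF d'[OF that, of c p] DERIV_minus[OF DERIV_ident]]
      by simp_all
    \<comment> \<open>Both determinants contain an odd number of derivatives and change sign under
      reversal; negating \<open>A\<close> alone undoes this and also keeps \<open>A'\<close>
      positive. The form \<open>- (- t)\<close> matches the conclusion of the lemma at
      \<open>- t\<close>.\<close>
    have "0 < (\<sigma> * \<rho> * ((r (- (- t)) - r e) \<bullet> cross3 \<gamma> \<alpha>)) * (\<sigma> * (v (- (- t)) \<bullet> \<gamma>)) - (- \<sigma> * ((r (- (- t)) - r e) \<bullet> \<gamma>)) * (- \<sigma> * \<rho> * (v (- (- t)) \<bullet> cross3 \<gamma> \<alpha>))"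
    proof (rule quotient_wronskian_pos[where e = "-b" and t = "-t"
          and A = "\<lambda>t. - \<sigma> * ((r (- t) - r e) \<bullet> \<gamma>)" and A' = "\<lambda>t. \<sigma> * (v (- t) \<bullet> \<gamma>)" and A'' = "\<lambda>t. - \<sigma> * (w (- t) \<bullet> \<gamma>)"
          and C = "\<lambda>t. \<sigma> * \<rho> * ((r (- t) - r e) \<bullet> cross3 \<gamma> \<alpha>)" and C' = "\<lambda>t. - \<sigma> * \<rho> * (v (- t) \<bullet> cross3 \<gamma> \<alpha>)" and C'' = "\<lambda>t. \<sigma> * \<rho> * (w (- t) \<bullet> cross3 \<gamma> \<alpha>)"])
      fix x assume "x \<in> {-b<..-t}"
      then have x: "- x \<in> {a<..<b}" using t by auto
      have "(- \<sigma> * \<rho> * (v (- x) \<bullet> cross3 \<gamma> \<alpha>)) * (- \<sigma> * (w (- x) \<bullet> \<gamma>)) - (\<sigma> * (v (- x) \<bullet> \<gamma>)) * (\<sigma> * \<rho> * (w (- x) \<bullet> cross3 \<gamma> \<alpha>))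
         = (\<gamma> \<bullet> \<gamma>) * (\<rho> * (\<alpha> \<bullet> cross3 (v (- x)) (w (- x))))"
        using lagrange_orthogonal_frame[of "v (- x)" "w (- x)"] \<sigma>(1) \<rho>(1) by auto
      then show "(- \<sigma> * \<rho> * (v (- x) \<bullet> cross3 \<gamma> \<alpha>)) * (- \<sigma> * (w (- x) \<bullet> \<gamma>)) - (\<sigma> * (v (- x) \<bullet> \<gamma>)) * (\<sigma> * \<rho> * (w (- x) \<bullet> cross3 \<gamma> \<alpha>)) > 0"
        using \<rho>(2)[OF x] gg by simp
    next
      fix x assume "x \<in> {- b..- t}"
      then have x: "- x \<in> {a..b}" using t by auto
      show "((\<lambda>t. - \<sigma> * ((r (- t) - r e) \<bullet> \<gamma>)) has_real_derivative \<sigma> * (v (- x) \<bullet> \<gamma>)) (at x)"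
        using dm[OF x, of "- \<sigma>" \<gamma>] by simp
      show "((\<lambda>t. \<sigma> * \<rho> * ((r (- t) - r e) \<bullet> cross3 \<gamma> \<alpha>)) has_real_derivative - \<sigma> * \<rho> * (v (- x) \<bullet> cross3 \<gamma> \<alpha>)) (at x)"
        using dm[OF x, of "\<sigma> * \<rho>" "cross3 \<gamma> \<alpha>"] by simp
    next
      fix x assume "x \<in> {- b<..- t}"
      then have x: "- x \<in> {a..b}" "- x \<in> {a<..<b}" using t by auto
      show "((\<lambda>t. \<sigma> * (v (- t) \<bullet> \<gamma>)) has_real_derivative - \<sigma> * (w (- x) \<bullet> \<gamma>)) (at x)"
        using dm'[OF x(1), of "\<sigma>" \<gamma>] by simp
      show "((\<lambda>t. - \<sigma> * \<rho> * (v (- t) \<bullet> cross3 \<gamma> \<alpha>)) has_real_derivative \<sigma> * \<rho> * (w (- x) \<bullet> cross3 \<gamma> \<alpha>)) (at x)"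
        using dm'[OF x(1), of "- \<sigma> * \<rho>" "cross3 \<gamma> \<alpha>"] by simp
      show "\<sigma> * (v (- x) \<bullet> \<gamma>) > 0" using \<sigma>(2)[OF x(2)] .
    qed (use t eb in auto)
    also have "\<dots> = (\<gamma> \<bullet> \<gamma>) * (\<rho> * (\<alpha> \<bullet> cross3 (r t - r e) (v t)))"
      using lagrange_orthogonal_frame[of "r t - r e" "v t"] \<sigma>(1) \<rho>(1) by auto
    finally show ?thesis using gg by (simp add: zero_less_mult_iff)
  qed
  have "(\<alpha> \<bullet> cross3 (r t - r e) (v t)) * (\<alpha> \<bullet> cross3 (v t) (w t)) =
     (\<rho> * (\<alpha> \<bullet> cross3 (r t - r e) (v t))) * (\<rho> * (\<alpha> \<bullet> cross3 (v t) (w t)))"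
    using \<rho>(1) by auto
  also have "\<dots> > 0" using main \<rho>(2)[OF t] by simp
  finally show ?thesis .
qed

text \<open>Signed coordinate, along the end tangent \<open>r e + u \<alpha>\<close>, of its
  intersection with the osculating plane at \<open>t\<close>.\<close>

definition cut :: "real \<Rightarrow> real" where
  "cut t = ((r t - r e) \<bullet> cross3 (v t) (w t)) / (\<alpha> \<bullet> cross3 (v t) (w t))"

text \<open>In the numerator the derivative of \<open>r\<close> drops out, being orthogonal to the
  binormal. The rest is an algebraic identity, due to
  \<open>(v \<times> w) \<times> (v \<times> j) = D v\<close> with \<open>D\<close> the triple
  product of the derivatives.\<close>

lemma cut_deriv:
  assumes t: "t \<in> {a<..<b}"
  shows "(cut has_real_derivative
    (cross3 (v t) (w t) \<bullet> j t) * (\<alpha> \<bullet> cross3 (r t - r e) (v t)) / (\<alpha> \<bullet> cross3 (v t) (w t))\<^sup>2) (at t)"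
proof -
  have t': "t \<in> {a..b}" using t by auto
  have dN: "((\<lambda>t. (r t - r e) \<bullet> cross3 (v t) (w t)) has_real_derivative
      (r t - r e) \<bullet> cross3 (v t) (j t)) (at t)"
    using has_real_derivative_inner[OF has_vector_derivative_diff[OF dr[OF t'] has_vector_derivative_const[of "r e"]] db[OF t']]
    by (simp add: dot_cross_self)
  have dK: "((\<lambda>t. \<alpha> \<bullet> cross3 (v t) (w t)) has_real_derivative \<alpha> \<bullet> cross3 (v t) (j t)) (at t)"
    by (rule has_real_derivative_inner_left[OF db[OF t']])
  have "((r t - r e) \<bullet> cross3 (v t) (j t)) * (\<alpha> \<bullet> cross3 (v t) (w t)) -
        ((r t - r e) \<bullet> cross3 (v t) (w t)) * (\<alpha> \<bullet> cross3 (v t) (j t))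
      = (cross3 (v t) (w t) \<bullet> j t) * (\<alpha> \<bullet> cross3 (r t - r e) (v t))"
    by (simp add: cross3_def inner_vec_def sum_3) algebra
  then show ?thesis
    using DERIV_divide[OF dN dK K[OF t]] unfolding cut_def power2_eq_square by simp
qed

text \<open>The same \<sigma> also fixes the sign of torsion determinant times
  \<open>\<alpha> \<bullet> cross3 (v t) (w t)\<close>; this is what later turns monotonicity into
  the side on which a vertex lies.\<close>

lemma cut_strict_mono:
  obtains \<sigma> where "\<sigma> = 1 \<or> \<sigma> = - 1" 
    "\<And>t. t \<in> {a<..<b} \<Longrightarrow> \<sigma> * ((cross3 (v t) (w t) \<bullet> j t) * (\<alpha> \<bullet> cross3 (v t) (w t))) > 0"
    "strict_mono_on {a<..<b} (\<lambda>t. \<sigma> * cut t)"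
proof -
  obtain \<sigma> where \<sigma>: "\<sigma> = 1 \<or> \<sigma> = - 1" 
    "\<And>t. t \<in> {a<..<b} \<Longrightarrow> \<sigma> * ((cross3 (v t) (w t) \<bullet> j t) * (\<alpha> \<bullet> cross3 (v t) (w t))) > 0"
  proof (rule constant_sign_on_interval[of a b "\<lambda>t. (cross3 (v t) (w t) \<bullet> j t) * (\<alpha> \<bullet> cross3 (v t) (w t))"])
    show "continuous_on {a<..<b} (\<lambda>t. (cross3 (v t) (w t) \<bullet> j t) * (\<alpha> \<bullet> cross3 (v t) (w t)))"
      by (intro continuous_intros continuous_on_cross continuous_on_subset[OF vcont] 
          continuous_on_subset[OF wcont] continuous_on_subset[OF jcont]) auto
  qed (use K D in auto)
  have "strict_mono_on {a<..<b} (\<lambda>t. \<sigma> * cut t)"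
  proof (rule strict_mono_on_if_deriv_pos)
    fix t assume t: "t \<in> {a<..<b}"
    show "((\<lambda>t. \<sigma> * cut t) has_real_derivative \<sigma> * ((cross3 (v t) (w t) \<bullet> j t) * (\<alpha> \<bullet> cross3 (r t - r e) (v t)) / (\<alpha> \<bullet> cross3 (v t) (w t))\<^sup>2)) (at t)"
      by (intro DERIV_cmult cut_deriv t)
    define d k E where "d = cross3 (v t) (w t) \<bullet> j t" and "k = \<alpha> \<bullet> cross3 (v t) (w t)"
      and "E = \<alpha> \<bullet> cross3 (r t - r e) (v t)"
    have "E * k > 0" "\<sigma> * (d * k) > 0" "k \<noteq> 0"
      using tangent_binormal_sign[OF t] \<sigma>(2)[OF t] K[OF t] by (auto simp: d_def k_def E_def)
    \<comment> \<open>The derivative \<open>d E / k^2\<close> is rewritten as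
      \<open>(d k) (E k) / k^4\<close>, where both products have known signs.\<close>
    then have "\<sigma> * (d * k) * (E * k) / (k\<^sup>2 * k\<^sup>2) > 0" by simp
    also have "\<sigma> * (d * k) * (E * k) / (k\<^sup>2 * k\<^sup>2) = \<sigma> * (d * E / k\<^sup>2)"
      using \<open>k \<noteq> 0\<close> by (simp add: field_simps power2_eq_square)
    finally show "0 < \<sigma> * ((cross3 (v t) (w t) \<bullet> j t) * (\<alpha> \<bullet> cross3 (r t - r e) (v t)) / (\<alpha> \<bullet> cross3 (v t) (w t))\<^sup>2)"
      by (simp add: d_def k_def E_def)
  qed
  with \<sigma> show thesis using that by blast
qed

text \<open>The quotient is invariant under rescaling of the binormal, so a limit of its rescaled
  form suffices.\<close>

lemma cut_tendsto:
  assumes "((\<lambda>t. c t *\<^sub>R cross3 (v t) (w t)) \<longlongrightarrow> g) F" "(r \<longlongrightarrow> p) F"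
    "\<forall>\<^sub>F t in F. c t \<noteq> 0" "\<alpha> \<bullet> g \<noteq> 0"
  shows "(cut \<longlongrightarrow> ((p - r e) \<bullet> g) / (\<alpha> \<bullet> g)) F"
proof -
  have "((\<lambda>t. ((r t - r e) \<bullet> (c t *\<^sub>R cross3 (v t) (w t))) / (\<alpha> \<bullet> (c t *\<^sub>R cross3 (v t) (w t)))) \<longlongrightarrow> ((p - r e) \<bullet> g) / (\<alpha> \<bullet> g)) F"
    by (intro tendsto_intros assms)
  then show ?thesis
    by (rule Lim_transform_eventually) (use assms(3) in \<open>auto elim!: eventually_mono simp: cut_def\<close>)
qed

end

section \<open>From signed parameters to distances and intersection points\<close>

lemma strict_monotone_abs:
  \<comment> \<open>With constant sign \<tau>, \<open>\<bar>f t\<bar>\<close> is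
    \<open>\<tau> * f t\<close>: increasing if \<sigma> and \<tau> agree, decreasing otherwise. The
    factor \<open>k\<close> is the length of a direction vector.\<close>
  fixes f :: "real \<Rightarrow> real"
  assumes "\<sigma> = 1 \<or> \<sigma> = (- 1 :: real)" "\<tau> = 1 \<or> \<tau> = (- 1 :: real)"
    and "strict_mono_on S (\<lambda>t. \<sigma> * f t)" and "\<And>t. t \<in> S \<Longrightarrow> \<tau> * f t > 0" and "k > 0"
  shows "strict_mono_on S (\<lambda>t. \<bar>f t\<bar> * k) \<or> strict_antimono_on S (\<lambda>t. \<bar>f t\<bar> * k)"
proof -
  have abs: "\<bar>f t\<bar> = \<tau> * f t" if "t \<in> S" for t
    using assms(2) assms(4)[OF that] by auto
  have less: "\<sigma> * f s < \<sigma> * f t" if "s \<in> S" "t \<in> S" "s < t" for s t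
    using strict_mono_onD[OF assms(3) that] .
  show ?thesis
  proof (cases "\<sigma> = \<tau>")
    case True
    then have "strict_mono_on S (\<lambda>t. \<bar>f t\<bar> * k)"
      using less assms(5) by (intro strict_mono_onI) (simp add: abs mult_strict_right_mono)
    then show ?thesis ..
  next
    case False
    then have "\<tau> = - \<sigma>" using assms(1,2) by auto
    then have "strict_antimono_on S (\<lambda>t. \<bar>f t\<bar> * k)"
      using less assms(5) by (intro monotone_onI) (simp add: abs mult_strict_right_mono)
    then show ?thesis ..
  qed
qed

lemma plane_inter_line_through:
  assumes "(q - p) \<bullet> n \<noteq> 0"
  shows "{X. (X - x) \<bullet> n = 0} \<inter> line_through p q
    = {p + (((x - p) \<bullet> n) / ((q - p) \<bullet> n)) *\<^sub>R (q - p)}"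
proof -
  have "((p + u *\<^sub>R (q - p)) - x) \<bullet> n = 0 \<longleftrightarrow> u = ((x - p) \<bullet> n) / ((q - p) \<bullet> n)" for u
    using assms by (simp add: field_simps inner_diff_left inner_add_left)
  then show ?thesis by (auto simp: line_through_def)
qed

section \<open>The tetrahedron of a segment\<close>

text \<open>
  The scaling \<open>c\<close> normalises the binormal, whose unnormalised form may tend to \<open>0\<close> at a singular
  endpoint.
\<close>

locale tetrahedron_segment =
  e0: tangent_end r v w j a b a \<alpha>0 \<gamma>0 + e1: tangent_end r v w j a b b \<alpha>1 \<gamma>1
  for r v w j :: "real \<Rightarrow> real ^ 3" and a b \<alpha>0 \<gamma>0 \<alpha>1 \<gamma>1 +
  fixes c :: "real \<Rightarrow> real"
  assumes c: "\<And>t. t \<in> {a<..<b} \<Longrightarrow> c t \<noteq> 0"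
    and lim0: "((\<lambda>t. c t *\<^sub>R cross3 (v t) (w t)) \<longlongrightarrow> \<gamma>0) (at_right a)"
    and lim1: "((\<lambda>t. c t *\<^sub>R cross3 (v t) (w t)) \<longlongrightarrow> \<gamma>1) (at_left b)"
    and a0g1: "\<alpha>0 \<bullet> \<gamma>1 \<noteq> 0" and a1g0: "\<alpha>1 \<bullet> \<gamma>0 \<noteq> 0"
    and h0: "(r a - r b) \<bullet> \<gamma>0 \<noteq> 0" and h1: "(r b - r a) \<bullet> \<gamma>1 \<noteq> 0"
    and off: "\<And>t. t \<in> {a<..<b} \<Longrightarrow> (r t - r a) \<bullet> cross3 (v t) (w t) \<noteq> 0"
begin

text \<open>\<open>lam\<close> and \<open>mu\<close> place the middle vertices \<open>v1\<close> and
  \<open>v2\<close> where each end tangent meets the osculating plane of the other end. They are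
  also the limits of the two cut parameters at the opposite ends.\<close>

definition "lam = ((r b - r a) \<bullet> \<gamma>1) / (\<alpha>0 \<bullet> \<gamma>1)"
definition "mu = ((r a - r b) \<bullet> \<gamma>0) / (\<alpha>1 \<bullet> \<gamma>0)"
definition "v1 = r a + lam *\<^sub>R \<alpha>0"
definition "v2 = r b + mu *\<^sub>R \<alpha>1"

abbreviation bin :: "real \<Rightarrow> real ^ 3" where "bin t \<equiv> cross3 (v t) (w t)"
abbreviation tors :: "real \<Rightarrow> real" where "tors t \<equiv> bin t \<bullet> j t"
abbreviation F1 :: "real \<Rightarrow> real" where "F1 t \<equiv> (v1 - r t) \<bullet> bin t"
abbreviation F2 :: "real \<Rightarrow> real" where "F2 t \<equiv> (v2 - r t) \<bullet> bin t"

lemma lam_nz: "lam \<noteq> 0" and mu_nz: "mu \<noteq> 0" and \<alpha>0_nz: "\<alpha>0 \<noteq> 0" and \<alpha>1_nz: "\<alpha>1 \<noteq> 0"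
  using h0 h1 a0g1 a1g0 by (auto simp: lam_def mu_def)

lemma r_tendsto: "(r \<longlongrightarrow> r a) (at_right a)" "(r \<longlongrightarrow> r b) (at_left b)"
  using e0.dr[of a] e0.dr[of b] e0.ab
  by (auto dest!: has_vector_derivative_continuous simp: continuous_at intro: tendsto_within_subset[of _ _ _ UNIV])

lemma c_ev: "\<forall>\<^sub>F t in at_right a. c t \<noteq> 0" "\<forall>\<^sub>F t in at_left b. c t \<noteq> 0"
  using c e0.ab by (auto simp: eventually_at_left_field eventually_at_right_field)

text \<open>\<open>F1\<close> is \<open>\<alpha>0 \<bullet> bin t\<close> times
  \<open>lam - cut t\<close>, and monotonicity keeps the cut on one side of its limit
  \<open>lam\<close> at \<open>b\<close>. Multiplying by \<open>tors\<close> removes the unknown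
  \<sigma>, so that the two ends can be compared.\<close>

lemma cut0_mono_F1_sign:
  obtains \<sigma> where "\<sigma> = 1 \<or> \<sigma> = - 1" "strict_mono_on {a<..<b} (\<lambda>t. \<sigma> * e0.cut t)"
    "\<And>t. t \<in> {a<..<b} \<Longrightarrow> F1 t * tors t > 0"
proof -
  obtain \<sigma> where \<sigma>: "\<sigma> = 1 \<or> \<sigma> = - 1" 
    "\<And>t. t \<in> {a<..<b} \<Longrightarrow> \<sigma> * (tors t * (\<alpha>0 \<bullet> bin t)) > 0"
    "strict_mono_on {a<..<b} (\<lambda>t. \<sigma> * e0.cut t)" using e0.cut_strict_mono by blast
  have lim: "((\<lambda>t. \<sigma> * e0.cut t) \<longlongrightarrow> \<sigma> * lam) (at_left b)"
    unfolding lam_def by (intro tendsto_intros e0.cut_tendsto[OF lim1 r_tendsto(2) c_ev(2) a0g1])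
  have "F1 t * tors t > 0" if t: "t \<in> {a<..<b}" for t
  proof -
    have F: "F1 t = (\<alpha>0 \<bullet> bin t) * (lam - e0.cut t)"
      using e0.K[OF t] by (simp add: v1_def e0.cut_def inner_add_left inner_diff_left field_simps)
    have "F1 t * tors t = (\<sigma> * (tors t * (\<alpha>0 \<bullet> bin t))) * (\<sigma> * lam - \<sigma> * e0.cut t)"
      unfolding F using \<sigma>(1) by (auto simp: algebra_simps)
    also have "\<dots> > 0"
      by (intro mult_pos_pos \<sigma>(2)[OF t])
        (use strict_mono_on_less_limit_right[OF \<sigma>(3) lim t] in simp)
    finally show ?thesis .
  qed
  with \<sigma> that show thesis by blast
qed

text \<open>Here \<open>mu\<close> is the limit at the left end \<open>a\<close>, so the comparison
  is reversed and \<open>F2\<close> gets the sign opposite to \<open>F1\<close>. The last conclusion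
  serves the distance from \<open>v2\<close>, which is proportional to
  \<open>\<bar>cut t - mu\<bar>\<close>.\<close>

lemma cut1_mono_F2_sign:
  obtains \<sigma> where "\<sigma> = 1 \<or> \<sigma> = - 1" "strict_mono_on {a<..<b} (\<lambda>t. \<sigma> * e1.cut t)"
    "\<And>t. t \<in> {a<..<b} \<Longrightarrow> F2 t * tors t < 0"
    "\<And>t. t \<in> {a<..<b} \<Longrightarrow> \<sigma> * (e1.cut t - mu) > 0"
proof -
  obtain \<sigma> where \<sigma>: "\<sigma> = 1 \<or> \<sigma> = - 1" 
    "\<And>t. t \<in> {a<..<b} \<Longrightarrow> \<sigma> * (tors t * (\<alpha>1 \<bullet> bin t)) > 0"
    "strict_mono_on {a<..<b} (\<lambda>t. \<sigma> * e1.cut t)" using e1.cut_strict_mono by blast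
  have lim: "((\<lambda>t. \<sigma> * e1.cut t) \<longlongrightarrow> \<sigma> * mu) (at_right a)"
    unfolding mu_def by (intro tendsto_intros e1.cut_tendsto[OF lim0 r_tendsto(1) c_ev(1) a1g0])
  have *: "\<sigma> * (e1.cut t - mu) > 0" if t: "t \<in> {a<..<b}" for t
    using strict_mono_on_greater_limit_left[OF \<sigma>(3) lim t] by (simp add: algebra_simps)
  have "F2 t * tors t < 0" if t: "t \<in> {a<..<b}" for t
  proof -
    have F: "F2 t = (\<alpha>1 \<bullet> bin t) * (mu - e1.cut t)"
      using e1.K[OF t] by (simp add: v2_def e1.cut_def inner_add_left inner_diff_left field_simps)
    have "F2 t * tors t = - ((\<sigma> * (tors t * (\<alpha>1 \<bullet> bin t))) * (\<sigma> * (e1.cut t - mu)))"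
      unfolding F using \<sigma>(1) by (auto simp: algebra_simps)
    also have "\<dots> < 0"
      using mult_pos_pos[OF \<sigma>(2)[OF t] *[OF t]] by simp
    finally show ?thesis .
  qed
  with \<sigma> * that show thesis by blast
qed

lemma F_sign: 
  assumes "t \<in> {a<..<b}"
  shows "F1 t * tors t > 0" "F2 t * tors t < 0" "F1 t \<noteq> F2 t"
proof -
  show F: "F1 t * tors t > 0" "F2 t * tors t < 0" using cut0_mono_F1_sign cut1_mono_F2_sign assms by metis+
  then show "F1 t \<noteq> F2 t" by auto
qed

lemma v1_ne_v2: "v1 \<noteq> v2"
proof -
  obtain t where "t \<in> {a<..<b}" using dense[OF e0.ab] by auto
  then show ?thesis using F_sign(3)[of t] by auto
qed

text \<open>Both middle vertices lie in both end planes, so their difference is orthogonal to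
  \<gamma>0 and \<gamma>1. Parallelism is stated without division.\<close>

lemma edge_direction:
  "((cross3 \<gamma>0 \<gamma>1) \<bullet> (cross3 \<gamma>0 \<gamma>1)) *\<^sub>R (v2 - v1) = ((cross3 \<gamma>0 \<gamma>1) \<bullet> (v2 - v1)) *\<^sub>R cross3 \<gamma>0 \<gamma>1"
  "cross3 \<gamma>0 \<gamma>1 \<bullet> cross3 \<gamma>0 \<gamma>1 \<noteq> 0" "cross3 \<gamma>0 \<gamma>1 \<bullet> (v2 - v1) \<noteq> 0"
proof -
  have 0: "(v2 - v1) \<bullet> \<gamma>0 = 0"
    using e0.orth a1g0 by (simp add: v1_def v2_def mu_def inner_add_left inner_diff_left field_simps)
  have 1: "(v2 - v1) \<bullet> \<gamma>1 = 0"
    using e1.orth a0g1 by (simp add: v1_def v2_def lam_def inner_add_left inner_diff_left field_simps)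
  have "cross3 (v2 - v1) (cross3 \<gamma>0 \<gamma>1) = 0"
    using Lagrange[of "v2 - v1" \<gamma>0 \<gamma>1] 0 1 by simp
  then have "cross3 (cross3 \<gamma>0 \<gamma>1) (v2 - v1) = 0"
    using cross_skew[of "v2 - v1"] by simp
  then show eq: "((cross3 \<gamma>0 \<gamma>1) \<bullet> (cross3 \<gamma>0 \<gamma>1)) *\<^sub>R (v2 - v1) = ((cross3 \<gamma>0 \<gamma>1) \<bullet> (v2 - v1)) *\<^sub>R cross3 \<gamma>0 \<gamma>1"
    using Lagrange[of "cross3 \<gamma>0 \<gamma>1" "cross3 \<gamma>0 \<gamma>1" "v2 - v1"] by simp
  \<comment> \<open>Independence of the two normals: \<alpha>0 is orthogonal to \<gamma>0 but not to
    \<gamma>1.\<close>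
  have "cross3 \<alpha>0 (cross3 \<gamma>0 \<gamma>1) = (\<alpha>0 \<bullet> \<gamma>1) *\<^sub>R \<gamma>0"
    using Lagrange[of \<alpha>0 \<gamma>0 \<gamma>1] e0.orth by simp
  then have "cross3 \<gamma>0 \<gamma>1 \<noteq> 0" using a0g1 e0.gnz by auto
  then show m: "cross3 \<gamma>0 \<gamma>1 \<bullet> cross3 \<gamma>0 \<gamma>1 \<noteq> 0" by simp
  show "cross3 \<gamma>0 \<gamma>1 \<bullet> (v2 - v1) \<noteq> 0"
    using eq m v1_ne_v2 by auto
qed

lemma edge_triple_nz:
  assumes t: "t \<in> {a<..<b}"
  shows "cross3 (v1 - r t) (v2 - r t) \<bullet> v t \<noteq> 0"
proof -
  let ?m = "cross3 \<gamma>0 \<gamma>1"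
  define A B A' B' where "A = (r t - r a) \<bullet> \<gamma>0" and "B = (r t - r b) \<bullet> \<gamma>1"
    and "A' = v t \<bullet> \<gamma>0" and "B' = v t \<bullet> \<gamma>1"
  \<comment> \<open>The two heights behave oppositely because \<open>t - a\<close> is positive and
    \<open>t - b\<close> negative.\<close>
  have A: "A * A' > 0" using e0.height_mult_deriv[OF t] t by (auto simp: A_def A'_def zero_less_mult_iff)
  have B: "B * B' < 0" using e1.height_mult_deriv[OF t] t by (auto simp: B_def B'_def zero_less_mult_iff mult_less_0_iff)
  \<comment> \<open>Since \<open>v1\<close> lies in both end planes, it may be replaced by
    \<open>r a\<close> against \<gamma>0 and by \<open>r b\<close> against \<gamma>1.\<close>
  have p0: "(v1 - r t) \<bullet> \<gamma>0 = - A"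
    using e0.orth by (simp add: v1_def A_def inner_add_left inner_diff_left)
  have p1: "(v1 - r t) \<bullet> \<gamma>1 = - B"
    using a0g1 by (simp add: v1_def B_def lam_def inner_add_left inner_diff_left)
  have "cross3 (v1 - r t) (v2 - r t) = cross3 (v1 - r t) (v2 - v1)"
    using cross_add_right[of "v1 - r t" "v2 - v1" "v1 - r t"] by simp
  then have "(?m \<bullet> ?m) * (cross3 (v1 - r t) (v2 - r t) \<bullet> v t)
      = cross3 (v1 - r t) ((?m \<bullet> ?m) *\<^sub>R (v2 - v1)) \<bullet> v t"
    by (simp add: cross_mult_right)
  also have "\<dots> = (?m \<bullet> (v2 - v1)) * (cross3 (v1 - r t) ?m \<bullet> v t)"
    unfolding edge_direction(1) by (simp add: cross_mult_right)
  also have "cross3 (v1 - r t) ?m \<bullet> v t = A * B' - B * A'"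
    unfolding Lagrange p0 p1 A'_def B'_def by (simp add: inner_diff_left inner_diff_right inner_commute)
  finally have *: "(?m \<bullet> ?m) * (cross3 (v1 - r t) (v2 - r t) \<bullet> v t) = (?m \<bullet> (v2 - v1)) * (A * B' - B * A')" .
  \<comment> \<open>Multiplication by \<open>A' * B'\<close> brings in the products
    \<open>A A'\<close> and \<open>B B'\<close> of known sign.\<close>
  have "(A * B' - B * A') * (A' * B') = (A * A') * B'\<^sup>2 + (- (B * B')) * A'\<^sup>2"
    by (simp add: algebra_simps power2_eq_square)
  also have "\<dots> > 0"
  proof (rule add_pos_pos)
    have "A' \<noteq> 0" "B' \<noteq> 0" using A B by auto
    then show "A * A' * B'\<^sup>2 > 0" "- (B * B') * A'\<^sup>2 > 0"
      using mult_pos_pos[OF A, of "B'\<^sup>2"] mult_neg_pos[OF B, of "A'\<^sup>2"] by simp_all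
  qed
  finally have "A * B' - B * A' \<noteq> 0" by auto
  with * edge_direction(2,3) show ?thesis by auto
qed

definition edge_param :: "real \<Rightarrow> real" where
  "edge_param t = F1 t / (F1 t - F2 t)"

lemma edge_param_deriv:
  assumes t: "t \<in> {a<..<b}"
  shows "(edge_param has_real_derivative
    tors t * (cross3 (v1 - r t) (v2 - r t) \<bullet> v t) / (F1 t - F2 t)\<^sup>2) (at t)"
proof -
  have t': "t \<in> {a..b}" using t by auto
  have dF: "((\<lambda>t. (p - r t) \<bullet> bin t) has_real_derivative (p - r t) \<bullet> cross3 (v t) (j t)) (at t)" for p
    using has_real_derivative_inner[OF has_vector_derivative_diff[OF has_vector_derivative_const[of p] e0.dr[OF t']] e0.db[OF t']]
    by (simp add: dot_cross_self)
  have nz: "F1 t - F2 t \<noteq> 0" using F_sign(3)[OF t] by simp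
  \<comment> \<open>The terms without \<open>p\<close> cancel; what remains is the Binet-Cauchy
    identity with \<open>(x \<times> y) \<times> (x \<times> z)\<close> a multiple of
    \<open>x\<close>.\<close>
  have key: "(q \<bullet> cross3 x z) * (q \<bullet> cross3 x y - p \<bullet> cross3 x y) - (q \<bullet> cross3 x y) * (q \<bullet> cross3 x z - p \<bullet> cross3 x z)
     = (cross3 x y \<bullet> z) * (cross3 q p \<bullet> x)" for p q x y z
    by (simp add: cross3_def inner_vec_def sum_3) algebra
  show ?thesis
    unfolding edge_param_def power2_eq_square
    using DERIV_divide[OF dF[of v1] DERIV_diff[OF dF[of v1] dF[of v2]] nz]
    unfolding key[of "v1 - r t" "v t" "j t" "w t" "v2 - r t"] .
qed

lemma edge_param_mono:
  obtains \<sigma> where "\<sigma> = 1 \<or> \<sigma> = - 1" "strict_mono_on {a<..<b} (\<lambda>t. \<sigma> * edge_param t)"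
proof -
  let ?N = "\<lambda>t. tors t * (cross3 (v1 - r t) (v2 - r t) \<bullet> v t)"
  obtain \<sigma> where \<sigma>: "\<sigma> = 1 \<or> \<sigma> = - 1" "\<And>t. t \<in> {a<..<b} \<Longrightarrow> \<sigma> * ?N t > 0"
  proof (rule constant_sign_on_interval[of a b ?N])
    show "continuous_on {a<..<b} ?N"
      by (intro continuous_intros continuous_on_cross continuous_on_subset[OF e0.vcont]
          continuous_on_subset[OF e0.wcont] continuous_on_subset[OF e0.jcont]
          continuous_on_subset[OF e0.rcont]) auto
  qed (use e0.D edge_triple_nz in auto)
  have "strict_mono_on {a<..<b} (\<lambda>t. \<sigma> * edge_param t)"
  proof (rule strict_mono_on_if_deriv_pos)
    fix t assume t: "t \<in> {a<..<b}"
    show "((\<lambda>t. \<sigma> * edge_param t) has_real_derivative \<sigma> * (?N t / (F1 t - F2 t)\<^sup>2)) (at t)"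
      by (intro DERIV_cmult edge_param_deriv t)
    have "(F1 t - F2 t)\<^sup>2 > 0" using F_sign(3)[OF t] by simp
    then show "\<sigma> * (?N t / (F1 t - F2 t)\<^sup>2) > 0"
      using divide_pos_pos[OF \<sigma>(2)[OF t]] by simp
  qed
  with \<sigma>(1) that show thesis by blast
qed

text \<open>\<open>F1\<close> and \<open>F2\<close> have opposite signs; expanding the fraction by
  \<open>tors t\<close> makes these signs definite.\<close>

lemma edge_param_pos:
  assumes "t \<in> {a<..<b}"
  shows "edge_param t > 0"
proof -
  have "edge_param t = (F1 t * tors t) / (F1 t * tors t - F2 t * tors t)"
    using e0.D[OF assms] by (simp add: edge_param_def left_diff_distrib[symmetric])
  also have "\<dots> > 0" using F_sign(1,2)[OF assms] by simp
  finally show ?thesis .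
qed

theorem osculating_cuts_monotone:
  "\<exists>f01 f12 f23 :: real \<Rightarrow> real ^ 3.
    (\<forall>t\<in>{a<..<b}.
        {X. (X - r t) \<bullet> bin t = 0} \<inter> line_through (r a) v1 = {f01 t} \<and>
        {X. (X - r t) \<bullet> bin t = 0} \<inter> line_through v1 v2 = {f12 t} \<and>
        {X. (X - r t) \<bullet> bin t = 0} \<inter> line_through v2 (r b) = {f23 t}) \<and>
    (strict_mono_on {a<..<b} (\<lambda>t. dist (r a) (f01 t)) \<or>
     strict_antimono_on {a<..<b} (\<lambda>t. dist (r a) (f01 t))) \<and>
    (strict_mono_on {a<..<b} (\<lambda>t. dist v1 (f12 t)) \<or>
     strict_antimono_on {a<..<b} (\<lambda>t. dist v1 (f12 t))) \<and>
    (strict_mono_on {a<..<b} (\<lambda>t. dist v2 (f23 t)) \<or>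
     strict_antimono_on {a<..<b} (\<lambda>t. dist v2 (f23 t)))"
\<comment> \<open>The three witnesses stay schematic and are fixed by the intersection points shown
  first.\<close>
proof (intro exI conjI ballI)
  fix t assume t: "t \<in> {a<..<b}"
  have "(v1 - r a) \<bullet> bin t = lam * (\<alpha>0 \<bullet> bin t)" by (simp add: v1_def)
  then show "{X. (X - r t) \<bullet> bin t = 0} \<inter> line_through (r a) v1 = {r a + e0.cut t *\<^sub>R \<alpha>0}"
    using plane_inter_line_through[of v1 "r a" "bin t" "r t"] e0.K[OF t] lam_nz
    by (simp add: v1_def e0.cut_def)
  have "(v2 - v1) \<bullet> bin t = - (F1 t - F2 t)" by (simp add: inner_diff_left)
  moreover have "(r t - v1) \<bullet> bin t = - F1 t" by (simp add: inner_diff_left)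
  ultimately show "{X. (X - r t) \<bullet> bin t = 0} \<inter> line_through v1 v2 = {v1 + edge_param t *\<^sub>R (v2 - v1)}"
    using plane_inter_line_through[of v2 v1 "bin t" "r t"] F_sign(3)[OF t]
    by (simp only: edge_param_def minus_divide_left[symmetric] minus_divide_right[symmetric] minus_minus neg_equal_0_iff_equal right_minus_eq not_False_eq_True)
  \<comment> \<open>The last edge starts at \<open>v2\<close>, while the cut is measured from
    \<open>r b\<close>; the next lines shift the origin, leaving the coordinate
    \<open>cut t - mu\<close> along \<alpha>1.\<close>
  have d: "r b - v2 = - mu *\<^sub>R \<alpha>1" by (simp add: v2_def)
  have "((r t - v2) \<bullet> bin t) / (- mu * (\<alpha>1 \<bullet> bin t)) = 1 - e1.cut t / mu"
    using e1.K[OF t] mu_nz by (simp add: e1.cut_def v2_def field_simps inner_diff_left inner_add_left)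
  then have "{X. (X - r t) \<bullet> bin t = 0} \<inter> line_through v2 (r b) = {v2 + (1 - e1.cut t / mu) *\<^sub>R (- mu *\<^sub>R \<alpha>1)}"
    using plane_inter_line_through[of "r b" v2 "bin t" "r t"] e1.K[OF t] mu_nz unfolding d by simp
  also have "(1 - e1.cut t / mu) *\<^sub>R (- mu *\<^sub>R \<alpha>1) = (e1.cut t - mu) *\<^sub>R \<alpha>1"
  proof -
    have "(1 - e1.cut t / mu) * - mu = e1.cut t - mu" using mu_nz by (simp add: field_simps)
    then show ?thesis by (simp only: scaleR_scaleR)
  qed
  finally show "{X. (X - r t) \<bullet> bin t = 0} \<inter> line_through v2 (r b) = {v2 + (e1.cut t - mu) *\<^sub>R \<alpha>1}" .
next
  obtain \<sigma> where \<sigma>: "\<sigma> = 1 \<or> \<sigma> = - 1" "strict_mono_on {a<..<b} (\<lambda>t. \<sigma> * e0.cut t)"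
    using cut0_mono_F1_sign by metis
  have cc: "continuous_on {a<..<b} e0.cut"
    by (meson DERIV_isCont continuous_at_imp_continuous_on e0.cut_deriv)
  \<comment> \<open>The distance from \<open>r a\<close> is the absolute value of the cut times
    \<open>norm \<alpha>0\<close>; by \<open>off\<close> the osculating plane avoids
    \<open>r a\<close>, so the cut keeps its sign.\<close>
  have cnz: "e0.cut t \<noteq> 0" if "t \<in> {a<..<b}" for t
    using off[OF that] e0.K[OF that] by (simp add: e0.cut_def)
  obtain \<tau> where \<tau>: "\<tau> = 1 \<or> \<tau> = - 1" "\<And>t. t \<in> {a<..<b} \<Longrightarrow> \<tau> * e0.cut t > 0"
    using constant_sign_on_interval[OF cc] cnz by metis
  show "strict_mono_on {a<..<b} (\<lambda>t. dist (r a) (r a + e0.cut t *\<^sub>R \<alpha>0)) \<or>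
     strict_antimono_on {a<..<b} (\<lambda>t. dist (r a) (r a + e0.cut t *\<^sub>R \<alpha>0))"
    using strict_monotone_abs[OF \<sigma>(1) \<tau>(1) \<sigma>(2) \<tau>(2), of "norm \<alpha>0"] \<alpha>0_nz by (simp add: dist_norm)
next
  obtain \<sigma> where \<sigma>: "\<sigma> = 1 \<or> \<sigma> = - 1" "strict_mono_on {a<..<b} (\<lambda>t. \<sigma> * edge_param t)"
    using edge_param_mono by metis
  show "strict_mono_on {a<..<b} (\<lambda>t. dist v1 (v1 + edge_param t *\<^sub>R (v2 - v1))) \<or>
     strict_antimono_on {a<..<b} (\<lambda>t. dist v1 (v1 + edge_param t *\<^sub>R (v2 - v1)))"
    using strict_monotone_abs[OF \<sigma>(1) _ \<sigma>(2), of 1 "norm (v2 - v1)"] v1_ne_v2 edge_param_pos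
    by (simp add: dist_norm)
next
  obtain \<sigma> where \<sigma>: "\<sigma> = 1 \<or> \<sigma> = - 1" "strict_mono_on {a<..<b} (\<lambda>t. \<sigma> * e1.cut t)"
    "\<And>t. t \<in> {a<..<b} \<Longrightarrow> \<sigma> * (e1.cut t - mu) > 0"
    using cut1_mono_F2_sign by metis
  have m: "strict_mono_on {a<..<b} (\<lambda>t. \<sigma> * (e1.cut t - mu))"
    using strict_mono_onD[OF \<sigma>(2)] by (intro strict_mono_onI) (simp add: right_diff_distrib)
  show "strict_mono_on {a<..<b} (\<lambda>t. dist v2 (v2 + (e1.cut t - mu) *\<^sub>R \<alpha>1)) \<or>
     strict_antimono_on {a<..<b} (\<lambda>t. dist v2 (v2 + (e1.cut t - mu) *\<^sub>R \<alpha>1))"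
    using strict_monotone_abs[OF \<sigma>(1) \<sigma>(1) m \<sigma>(3), of "norm \<alpha>1"] \<alpha>1_nz by (simp add: dist_norm)
qed

end

section \<open>Rational curves\<close>

definition regular_set :: "real poly ^ 3 \<Rightarrow> real set" where
  "regular_set Q = {t. \<forall>i. poly (Q $ i) t \<noteq> 0}"

text \<open>The quotient rule is left unreduced: squared denominators have the same zeros, so
  differentiation can be iterated on one regular set.\<close>

definition deriv_num :: "real poly ^ 3 \<Rightarrow> real poly ^ 3 \<Rightarrow> real poly ^ 3" where
  "deriv_num P Q = (\<chi> i. pderiv (P $ i) * Q $ i - P $ i * pderiv (Q $ i))"

definition deriv_den :: "real poly ^ 3 \<Rightarrow> real poly ^ 3" where
  "deriv_den Q = (\<chi> i. Q $ i * Q $ i)"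

lemma regular_set_deriv_den [simp]: "regular_set (deriv_den Q) = regular_set Q"
  by (simp add: regular_set_def deriv_den_def)

lemma open_regular_set: "open (regular_set Q)"
proof -
  have "regular_set Q = (\<Inter>i. {t. poly (Q $ i) t \<noteq> 0})"
    by (auto simp: regular_set_def)
  moreover have "open {t. poly (Q $ i) t \<noteq> 0}" for i
    by (intro open_Collect_neq continuous_intros)
  ultimately show ?thesis by (simp add: open_INT)
qed

lemma rcurve_has_vector_derivative:
  assumes "t \<in> regular_set Q"
  shows "(rcurve P Q has_vector_derivative rcurve (deriv_num P Q) (deriv_den Q) t) (at t)"
proof -
  have comp: "((\<lambda>t. rcurve P Q t $ i) has_real_derivative rcurve (deriv_num P Q) (deriv_den Q) t $ i) (at t)" for i
  proof -
    have "poly (Q $ i) t \<noteq> 0" using assms by (simp add: regular_set_def)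
    from DERIV_divide[OF poly_DERIV[of "P $ i" t] poly_DERIV[of "Q $ i" t] this]
    show ?thesis by (simp add: rcurve_def deriv_num_def deriv_den_def)
  qed
  show ?thesis
    unfolding has_vector_derivative_def
  proof (rule has_derivative_componentwise_within[THEN iffD2], rule ballI)
    fix k :: "real ^ 3" assume "k \<in> Basis"
    then obtain i where k: "k = axis i 1" by (auto simp: Basis_vec_def)
    show "((\<lambda>x. rcurve P Q x \<bullet> k) has_derivative (\<lambda>x. x *\<^sub>R rcurve (deriv_num P Q) (deriv_den Q) t \<bullet> k)) (at t)"
      using comp[of i] by (simp add: k inner_axis has_field_derivative_def mult_commute_abs)
  qed
qed

text \<open>Agreement with a rational curve is known only away from the poles; the openness of that
  set makes it enough for the derivative.\<close>

lemma vector_derivative_eq_on_regular_set: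
  assumes "\<And>s. s \<in> regular_set Q \<Longrightarrow> f s = rcurve P' Q' s" "regular_set Q' = regular_set Q" 
    and t: "t \<in> regular_set Q"
  shows "(f has_vector_derivative vector_derivative f (at t)) (at t)"
    and "vector_derivative f (at t) = rcurve (deriv_num P' Q') (deriv_den Q') t"
proof -
  have *: "(f has_vector_derivative rcurve (deriv_num P' Q') (deriv_den Q') t) (at t)"
    by (rule has_vector_derivative_transform_within_open[OF rcurve_has_vector_derivative open_regular_set[of Q] t])
      (use assms in auto)
  then show "vector_derivative f (at t) = rcurve (deriv_num P' Q') (deriv_den Q') t"
    by (rule vector_derivative_at)
  then show "(f has_vector_derivative vector_derivative f (at t)) (at t)"
    using * by simp
qed

text \<open>The first two derivatives are exposed as rational curves, for the limits of tangent and
  binormal at a singular start; of the third only continuity is recorded.\<close>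

lemma rcurve_derivatives:
  fixes P Q :: "real poly ^ 3"
  defines "r \<equiv> rcurve P Q"
  obtains P1 Q1 P2 Q2 where
    "regular_set Q1 = regular_set Q" "regular_set Q2 = regular_set Q"
    "\<And>t. t \<in> regular_set Q \<Longrightarrow> d1 r t = rcurve P1 Q1 t"
    "\<And>t. t \<in> regular_set Q \<Longrightarrow> d2 r t = rcurve P2 Q2 t"
    "\<And>t. t \<in> regular_set Q \<Longrightarrow> (r has_vector_derivative d1 r t) (at t)"
    "\<And>t. t \<in> regular_set Q \<Longrightarrow> (d1 r has_vector_derivative d2 r t) (at t)"
    "\<And>t. t \<in> regular_set Q \<Longrightarrow> (d2 r has_vector_derivative d3 r t) (at t)"
    "\<And>t. t \<in> regular_set Q \<Longrightarrow> isCont (d3 r) t"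
proof -
  note D = vector_derivative_eq_on_regular_set
  have A1: "d1 r t = rcurve (deriv_num P Q) (deriv_den Q) t"
      "(r has_vector_derivative d1 r t) (at t)" if "t \<in> regular_set Q" for t
    using D[of Q r P Q t] that by (auto simp: d1_def r_def)
  define P1 Q1 where "P1 = deriv_num P Q" and "Q1 = deriv_den Q"
  have Q1: "regular_set Q1 = regular_set Q" by (simp add: Q1_def)
  have A2: "d2 r t = rcurve (deriv_num P1 Q1) (deriv_den Q1) t"
      "(d1 r has_vector_derivative d2 r t) (at t)" if "t \<in> regular_set Q" for t
    using D[of Q "d1 r" P1 Q1 t] that A1(1) Q1 by (auto simp: d2_def P1_def Q1_def)
  define P2 Q2 where "P2 = deriv_num P1 Q1" and "Q2 = deriv_den Q1"
  have Q2: "regular_set Q2 = regular_set Q" by (simp add: Q2_def Q1)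
  have A3: "d3 r t = rcurve (deriv_num P2 Q2) (deriv_den Q2) t"
      "(d2 r has_vector_derivative d3 r t) (at t)" if "t \<in> regular_set Q" for t
    using D[of Q "d2 r" P2 Q2 t] that A2(1) Q2 by (auto simp: d3_def P2_def Q2_def)
  have "isCont (d3 r) t" if "t \<in> regular_set Q" for t
    using D(1)[of Q "d3 r" "deriv_num P2 Q2" "deriv_den Q2" t] that A3(1) Q2
    by (auto dest: has_vector_derivative_continuous)
  with A1 A2 A3 Q1 Q2 show thesis
    by (intro that[of Q1 Q2 P1 P2]) (auto simp: P1_def Q1_def P2_def Q2_def)
qed

lemma cross3_rcurve:
  assumes "regular_set Q1 = regular_set Q" "regular_set Q2 = regular_set Q"
  obtains P' Q' where "regular_set Q' = regular_set Q"
    "\<And>t. t \<in> regular_set Q \<Longrightarrow> cross3 (rcurve P1 Q1 t) (rcurve P2 Q2 t) = rcurve P' Q' t"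
proof -
  define n where "n i k = P1 $ i * P2 $ k * (Q1 $ k * Q2 $ i) - P1 $ k * P2 $ i * (Q1 $ i * Q2 $ k)" for i k
  define d where "d i k = Q1 $ i * Q2 $ k * (Q1 $ k * Q2 $ i)" for i k
  have nz: "t \<in> regular_set Q \<Longrightarrow> poly (Q1 $ i) t \<noteq> 0 \<and> poly (Q2 $ i) t \<noteq> 0" for t i
    using assms by (auto simp: regular_set_def)
  show thesis
  proof
    show "regular_set (vector [d 2 3, d 3 1, d 1 2]) = regular_set Q"
    proof -
      have "regular_set (vector [d 2 3, d 3 1, d 1 2]) = regular_set Q1 \<inter> regular_set Q2"
        by (auto simp: regular_set_def forall_3 d_def)
      then show ?thesis using assms by simp
    qed
    show "cross3 (rcurve P1 Q1 t) (rcurve P2 Q2 t) = rcurve (vector [n 2 3, n 3 1, n 1 2]) (vector [d 2 3, d 3 1, d 1 2]) t"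
      if "t \<in> regular_set Q" for t
      using nz[OF that] by (simp add: vec_eq_iff forall_3 cross3_def rcurve_def n_def d_def diff_frac_eq)
  qed
qed

text \<open>\<open>k\<close> is the largest power of the linear factor dividing all components; it
  is bounded by the order of the root in a nonzero component.\<close>

lemma poly_vec_factor_root:
  fixes P :: "real poly ^ 3"
  assumes "P \<noteq> 0"
  obtains k M where "\<And>i. P $ i = [:- s, 1:] ^ k * M $ i" "\<exists>i. poly (M $ i) s \<noteq> 0"
proof -
  let ?R = "\<lambda>k. \<forall>i. [:- s, 1:] ^ k dvd P $ i"
  obtain i0 where i0: "P $ i0 \<noteq> 0" using assms by (auto simp: vec_eq_iff)
  have bd: "?R k \<Longrightarrow> k \<le> order s (P $ i0)" for k
    using i0 by (metis order_divides)
  define k where "k = Greatest ?R"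
  have k: "?R k" unfolding k_def by (rule GreatestI_ex_nat[of ?R, OF _ bd]) (auto intro: exI[of _ 0])
  have max: "\<not> ?R (Suc k)"
    using Greatest_le_nat[of ?R "Suc k", OF _ bd] by (fastforce simp: k_def)
  define M where "M = (\<chi> i. P $ i div [:- s, 1:] ^ k)"
  have M: "P $ i = [:- s, 1:] ^ k * M $ i" for i
    using k by (simp add: M_def)
  moreover have "\<exists>i. poly (M $ i) s \<noteq> 0"
  proof (rule ccontr)
    assume "\<not> (\<exists>i. poly (M $ i) s \<noteq> 0)"
    then have "[:- s, 1:] dvd M $ i" for i by (simp add: poly_eq_0_iff_dvd)
    then have "?R (Suc k)" by (subst M) (metis dvd_refl mult_dvd_mono power_Suc2)
    with max show False by blast
  qed
  ultimately show thesis using that by blast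
qed

text \<open>Dividing the numerators by their common power of \<open>t - s\<close> leaves a curve
  that is continuous and nonzero at \<open>s\<close>. To the right of \<open>s\<close> that power is
  positive and cancels on normalising. A single nonzero value serves to exclude the zero
  curve.\<close>

lemma rcurve_direction_tendsto:
  assumes s: "s \<in> regular_set Q" and nz: "rcurve P Q t \<noteq> 0"
  shows "\<exists>l. ((\<lambda>t. (1 / norm (rcurve P Q t)) *\<^sub>R rcurve P Q t) \<longlongrightarrow> l) (at_right s)"
proof -
  have "P \<noteq> 0"
  proof
    assume "P = 0"
    then show False using nz by (simp add: rcurve_def vec_eq_iff)
  qed
  then obtain k M where M: "\<And>i. P $ i = [:- s, 1:] ^ k * M $ i" "\<exists>i. poly (M $ i) s \<noteq> 0"
    using poly_vec_factor_root by metis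
  have fac: "rcurve P Q t = (t - s) ^ k *\<^sub>R rcurve M Q t" for t
    by (simp add: vec_eq_iff rcurve_def M(1) poly_power)
  have c: "isCont (rcurve M Q) s"
    using rcurve_has_vector_derivative[OF s] by (rule has_vector_derivative_continuous)
  have n: "rcurve M Q s \<noteq> 0"
    using M(2) s by (auto simp: rcurve_def vec_eq_iff regular_set_def)
  have "((\<lambda>t. (1 / norm (rcurve M Q t)) *\<^sub>R rcurve M Q t) \<longlongrightarrow> (1 / norm (rcurve M Q s)) *\<^sub>R rcurve M Q s) (at s)"
    by (intro tendsto_intros c[unfolded isCont_def]) (use n in auto)
  then have "((\<lambda>t. (1 / norm (rcurve M Q t)) *\<^sub>R rcurve M Q t) \<longlongrightarrow> (1 / norm (rcurve M Q s)) *\<^sub>R rcurve M Q s) (at_right s)"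
    by (rule tendsto_within_subset) simp
  then have "((\<lambda>t. (1 / norm (rcurve P Q t)) *\<^sub>R rcurve P Q t) \<longlongrightarrow> (1 / norm (rcurve M Q s)) *\<^sub>R rcurve M Q s) (at_right s)"
    by (rule Lim_transform_eventually)
      (auto simp: fac eventually_at_right_field intro!: exI[of _ "s + 1"])
  then show ?thesis ..
qed

lemma Lim_one_sided_isCont:
  fixes f :: "real \<Rightarrow> 'a::t2_space"
  assumes "isCont f s"
  shows "Lim (at_right s) f = f s" "Lim (at_left s) f = f s"
  using assms unfolding isCont_def
  by (auto intro!: tendsto_Lim intro: tendsto_within_subset[of _ _ _ UNIV])

section \<open>Admissible segments as instances of the tetrahedron locale\<close>

theorem theorem3:
  fixes P Q :: "real poly ^ 3" and I :: "real set" and t0 t1 :: real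
  defines "r \<equiv> rcurve P Q"
  assumes "is_interval I"
    and "\<forall>t\<in>I. \<forall>i. poly (Q $ i) t \<noteq> 0"
    and "proper_param P Q"
    and "\<not> contained_in_plane r I"
    and "admissible r I t0 t1"
  shows "\<exists>f01 f12 f23 :: real \<Rightarrow> real ^ 3.
    (\<forall>t\<in>{t0<..<t1}.
        osc r t \<inter> line_through (r t0) (tetra_v1 r t0 t1) = {f01 t} \<and>
        osc r t \<inter> line_through (tetra_v1 r t0 t1) (tetra_v2 r t0 t1) = {f12 t} \<and>
        osc r t \<inter> line_through (tetra_v2 r t0 t1) (r t1) = {f23 t}) \<and>
    (strict_mono_on {t0<..<t1} (\<lambda>t. dist (r t0) (f01 t)) \<or>
     strict_antimono_on {t0<..<t1} (\<lambda>t. dist (r t0) (f01 t))) \<and>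
    (strict_mono_on {t0<..<t1} (\<lambda>t. dist (tetra_v1 r t0 t1) (f12 t)) \<or>
     strict_antimono_on {t0<..<t1} (\<lambda>t. dist (tetra_v1 r t0 t1) (f12 t))) \<and>
    (strict_mono_on {t0<..<t1} (\<lambda>t. dist (tetra_v2 r t0 t1) (f23 t)) \<or>
     strict_antimono_on {t0<..<t1} (\<lambda>t. dist (tetra_v2 r t0 t1) (f23 t)))"
proof -
  let ?b = "\<lambda>t. cross3 (d1 r t) (d2 r t)"
  have lt: "t0 < t1" and sub: "{t0..t1} \<subseteq> I" and reg: "\<And>t. t \<in> {t0<..t1} \<Longrightarrow> \<not> character_param r I t"
    and adm: "\<And>s1 s2. t0 \<le> s1 \<Longrightarrow> s1 < s2 \<Longrightarrow> s2 \<le> t1 \<Longrightarrow>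
        alpha_p r s1 \<bullet> gamma_m r s2 \<noteq> 0 \<and> alpha_m r s2 \<bullet> gamma_p r s1 \<noteq> 0 \<and>
        (r s1 - r s2) \<bullet> gamma_m r s2 \<noteq> 0 \<and> (r s2 - r s1) \<bullet> gamma_p r s1 \<noteq> 0"
    using assms(6) unfolding admissible_def by blast+
  have S: "{t0..t1} \<subseteq> regular_set Q" using sub assms(3) by (auto simp: regular_set_def)
  obtain P1 Q1 P2 Q2 where der:
    "regular_set Q1 = regular_set Q" "regular_set Q2 = regular_set Q"
    "\<And>t. t \<in> regular_set Q \<Longrightarrow> d1 r t = rcurve P1 Q1 t"
    "\<And>t. t \<in> regular_set Q \<Longrightarrow> d2 r t = rcurve P2 Q2 t"
    "\<And>t. t \<in> regular_set Q \<Longrightarrow> (r has_vector_derivative d1 r t) (at t)"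
    "\<And>t. t \<in> regular_set Q \<Longrightarrow> (d1 r has_vector_derivative d2 r t) (at t)"
    "\<And>t. t \<in> regular_set Q \<Longrightarrow> (d2 r has_vector_derivative d3 r t) (at t)"
    "\<And>t. t \<in> regular_set Q \<Longrightarrow> isCont (d3 r) t"
    by (rule rcurve_derivatives[of Q P, folded r_def], rule that) assumption+
  obtain PB QB where B: "regular_set QB = regular_set Q" 
    "\<And>t. t \<in> regular_set Q \<Longrightarrow> ?b t = rcurve PB QB t"
    using cross3_rcurve[OF der(1,2), of P1 P2] der(3,4) by metis
  have v_nz: "d1 r t \<noteq> 0" and b_nz: "?b t \<noteq> 0" and D_nz: "?b t \<bullet> d3 r t \<noteq> 0"
    if "t \<in> {t0<..t1}" for t
  proof -
    show "d1 r t \<noteq> 0" using reg[OF that] by (auto simp: character_param_def singular_param_def)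
    show "?b t \<noteq> 0" using reg[OF that] by (auto simp: character_param_def curvature_def)
    have "d1 r t \<bullet> cross3 (d2 r t) (d3 r t) = ?b t \<bullet> d3 r t"
      by (metis cross_triple inner_commute)
    then show "?b t \<bullet> d3 r t \<noteq> 0"
      using reg[OF that] by (simp add: character_param_def torsion_vanishes_def dot_cross_det)
  qed
  have c1: "isCont (d1 r) t" and c2: "isCont (d2 r) t" if "t \<in> regular_set Q" for t
    using der(6,7)[OF that] by (auto dest: has_vector_derivative_continuous)
  have utan_cont: "isCont (utan r) t" and ubin_cont: "isCont (ubin r) t" if "t \<in> {t0<..t1}" for t
  proof -
    have t: "t \<in> regular_set Q" using that S by auto
    show "isCont (utan r) t"
      unfolding utan_def[abs_def] using v_nz[OF that] by (intro continuous_intros c1[OF t]) auto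
    show "isCont (ubin r) t"
      unfolding ubin_def[abs_def] using b_nz[OF that]
      by (intro continuous_intros continuous_cross c1[OF t] c2[OF t]) auto
  qed
  \<comment> \<open>Away from \<open>t0\<close> the one-sided limits are plain values, so
    admissibility becomes a statement about the derivatives.\<close>
  have lims: "alpha_p r t = utan r t" "alpha_m r t = utan r t" "gamma_p r t = ubin r t" "gamma_m r t = ubin r t"
    if "t \<in> {t0<..t1}" for t
    using Lim_one_sided_isCont[OF utan_cont[OF that]] Lim_one_sided_isCont[OF ubin_cont[OF that]]
    by (simp_all add: alpha_p_def alpha_m_def gamma_p_def gamma_m_def)
  have inner_utan: "utan r t \<bullet> x \<noteq> 0 \<longleftrightarrow> d1 r t \<bullet> x \<noteq> 0"
    and inner_ubin: "x \<bullet> ubin r t \<noteq> 0 \<longleftrightarrow> x \<bullet> ?b t \<noteq> 0" if "t \<in> {t0<..t1}" for t x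
    using v_nz[OF that] b_nz[OF that] by (simp_all add: utan_def ubin_def)
  have t1_in: "t1 \<in> {t0<..t1}" and t1_reg: "t1 \<in> regular_set Q" and t0_reg: "t0 \<in> regular_set Q"
    using lt S by auto
  have ev: "\<forall>\<^sub>F t in at_right t0. t \<in> regular_set Q"
    using open_regular_set t0_reg by (meson eventually_at_topological eventually_at_filter)
  \<comment> \<open>\<open>t0\<close> may be singular, so existence of the limit has to be
    established before \<open>Lim\<close> can be identified with it. The nonzero value is taken at
    \<open>t1\<close>.\<close>
  have alpha0: "(utan r \<longlongrightarrow> alpha_p r t0) (at_right t0)"
  proof -
    obtain l where "((\<lambda>t. (1 / norm (rcurve P1 Q1 t)) *\<^sub>R rcurve P1 Q1 t) \<longlongrightarrow> l) (at_right t0)"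
      using rcurve_direction_tendsto[of t0 Q1 P1 t1] der(1,3) t0_reg t1_reg v_nz[OF t1_in] by auto
    then have "(utan r \<longlongrightarrow> l) (at_right t0)"
      by (rule Lim_transform_eventually) (use ev in \<open>auto elim!: eventually_mono simp: utan_def der(3)\<close>)
    then show ?thesis unfolding alpha_p_def by (metis tendsto_Lim trivial_limit_at_right_real)
  qed
  have gamma0: "(ubin r \<longlongrightarrow> gamma_p r t0) (at_right t0)"
  proof -
    obtain l where "((\<lambda>t. (1 / norm (rcurve PB QB t)) *\<^sub>R rcurve PB QB t) \<longlongrightarrow> l) (at_right t0)"
      using rcurve_direction_tendsto[of t0 QB PB t1] B t0_reg t1_reg b_nz[OF t1_in] by auto
    then have "(ubin r \<longlongrightarrow> l) (at_right t0)"
      by (rule Lim_transform_eventually) (use ev in \<open>auto elim!: eventually_mono simp: ubin_def B(2)\<close>)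
    then show ?thesis unfolding gamma_p_def by (metis tendsto_Lim trivial_limit_at_right_real)
  qed
  have perp: "utan r t \<bullet> ubin r t = 0" for t by (simp add: utan_def ubin_def dot_cross_self)
  have orth0: "alpha_p r t0 \<bullet> gamma_p r t0 = 0"
    using tendsto_inner[OF alpha0 gamma0] by (simp add: perp LIM_const_eq tendsto_const_iff)
  have orth1: "alpha_m r t1 \<bullet> gamma_m r t1 = 0"
    using lims[OF t1_in] perp by simp
  have gamma1: "(ubin r \<longlongrightarrow> gamma_m r t1) (at_left t1)"
    using ubin_cont[OF t1_in] lims(4)[OF t1_in] unfolding isCont_def
    by (auto intro: tendsto_within_subset[of _ _ _ UNIV])
  note end_adm = adm[OF order_refl lt order_refl]
  \<comment> \<open>Conditions (I) and (III) for the pair \<open>t0\<close>, \<open>t\<close>, and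
    (I) for the pair \<open>t\<close>, \<open>t1\<close>, freed of the nonzero normalising
    factors.\<close>
  have adm0: "alpha_p r t0 \<bullet> ?b t \<noteq> 0" "d1 r t \<bullet> gamma_p r t0 \<noteq> 0" "(r t - r t0) \<bullet> ?b t \<noteq> 0"
    and adm1: "alpha_m r t1 \<bullet> ?b t \<noteq> 0" "d1 r t \<bullet> gamma_m r t1 \<noteq> 0"
    if t: "t \<in> {t0<..<t1}" for t
  proof -
    have t': "t \<in> {t0<..t1}" using t by auto
    have "(r t0 - r t) \<bullet> ?b t \<noteq> 0"
      using adm[of t0 t] t lims[OF t'] inner_ubin[OF t'] by auto
    then show "(r t - r t0) \<bullet> ?b t \<noteq> 0" by (simp add: inner_diff_left)
    show "alpha_p r t0 \<bullet> ?b t \<noteq> 0" "d1 r t \<bullet> gamma_p r t0 \<noteq> 0"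
      using adm[of t0 t] t lims[OF t'] inner_utan[OF t'] inner_ubin[OF t'] by auto
    show "alpha_m r t1 \<bullet> ?b t \<noteq> 0" "d1 r t \<bullet> gamma_m r t1 \<noteq> 0"
      using adm[of t t1] t lims[OF t'] inner_utan[OF t'] inner_ubin[OF t'] by auto
  qed
  interpret tetrahedron_segment r "d1 r" "d2 r" "d3 r" t0 t1 "alpha_p r t0" "gamma_p r t0"
    "alpha_m r t1" "gamma_m r t1" "\<lambda>t. 1 / norm (?b t)"
  proof
    show "continuous_on {t0..t1} (d3 r)"
      using der(8) S by (auto intro: continuous_at_imp_continuous_on)
    show "((\<lambda>t. (1 / norm (?b t)) *\<^sub>R ?b t) \<longlongrightarrow> gamma_p r t0) (at_right t0)"
      using gamma0 unfolding ubin_def[abs_def] .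
    show "((\<lambda>t. (1 / norm (?b t)) *\<^sub>R ?b t) \<longlongrightarrow> gamma_m r t1) (at_left t1)"
      using gamma1 unfolding ubin_def[abs_def] .
    show "(r t0 - r t1) \<bullet> gamma_p r t0 \<noteq> 0" "(r t1 - r t0) \<bullet> gamma_m r t1 \<noteq> 0"
      using end_adm by (auto simp: inner_diff_left)
    show "gamma_p r t0 \<noteq> 0" "gamma_m r t1 \<noteq> 0" using end_adm by auto
  qed (use lt S der(5-7) D_nz b_nz orth0 orth1 adm0 adm1 end_adm in \<open>auto\<close>)
  \<comment> \<open>The tangent lies in its own end plane and is transversal to the other one, so
    the intersection is a single point.\<close>
  have "tetra_v1 r t0 t1 = v1"
    unfolding tetra_v1_def
  proof (rule the_equality)
    show "v1 \<in> tangent_p r t0 \<inter> tetra_L r t0 t1"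
      using orth0 end_adm
      by (auto simp: v1_def lam_def tangent_p_def tetra_L_def osc_p_def osc_m_def inner_add_left inner_diff_left)
    fix X assume "X \<in> tangent_p r t0 \<inter> tetra_L r t0 t1"
    then obtain l where X: "X = r t0 + l *\<^sub>R alpha_p r t0" "(X - r t1) \<bullet> gamma_m r t1 = 0"
      by (auto simp: tangent_p_def tetra_L_def osc_m_def)
    then have "l = lam"
      using end_adm by (simp add: lam_def inner_add_left inner_diff_left field_simps)
    then show "X = v1" by (simp add: X(1) v1_def)
  qed
  moreover have "tetra_v2 r t0 t1 = v2"
    unfolding tetra_v2_def
  proof (rule the_equality)
    show "v2 \<in> tangent_m r t1 \<inter> tetra_L r t0 t1"
      using orth1 end_adm
      by (auto simp: v2_def mu_def tangent_m_def tetra_L_def osc_p_def osc_m_def inner_add_left inner_diff_left)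
    fix X assume "X \<in> tangent_m r t1 \<inter> tetra_L r t0 t1"
    then obtain l where X: "X = r t1 + l *\<^sub>R alpha_m r t1" "(X - r t0) \<bullet> gamma_p r t0 = 0"
      by (auto simp: tangent_m_def tetra_L_def osc_p_def)
    then have "l = mu"
      using end_adm by (simp add: mu_def inner_add_left inner_diff_left field_simps)
    then show "X = v2" by (simp add: X(1) v2_def)
  qed
  moreover have "osc r t = {X. (X - r t) \<bullet> ?b t = 0}" if "t \<in> {t0<..<t1}" for t
    using inner_ubin[of t] that by (auto simp: osc_def)
  ultimately show ?thesis
    using osculating_cuts_monotone by simp
qed

end
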